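(* Let $X$ be a compact metric space and let $\mathcal{L}$ be a transfer operator on $C^0(X,\mathbb{C})$. Let $\mu\in\mathcal{M}$ be a probability measure fixed by ${\mathcal{L}^*}^p$ (that is, ${\mathcal{L}^*}^p\mu=\mu$) for some natural number $p\ge1$. Then, for any function $\varphi\in L_\infty$, the following limit exists for $\mu$-a.e. $x\in X$: $$\widetilde\varphi_p(x):=\lim_{n\to+\infty}\frac1n\sum_{j=0}^{n-1}(\mathcal{L}^{jp}\varphi)(x).$$ If besides $\mu$ is ergodic for ${\mathcal{L}^*}^p$, then $$\widetilde\varphi_p(x)=\int\varphi\,d\mu\quad\text{for }\mu\text{-a.e. }x\in X.$$
   Context: $X$ is a compact metric space, $\mathcal{A}$ its Borel sigma-algebra, $\mathcal{M}$ the set of all probability measures on $(X,\mathcal{A})$, and $C^0(X,\mathbb{C})$ the space of continuous functions $X\to\mathbb{C}$ with the supremum norm. A transfer operator is a linear operator $\mathcal{L}:C^0(X,\mathbb{C})\to C^0(X,\mathbb{C})$ such that: (1) $\mathcal{L}\varphi$ is real and non-negative whenever $\varphi$ is real and non-negative; (2) $\max_{x\in X}|(\mathcal{L}\varphi)(x)|\le\max_{x\in X}|\varphi(x)|$ for all $\varphi\in C^0(X,\mathbb{C})$, and $\mathcal{L}1=1$. Its dual transfer operator $\mathcal{L}^*:\mathcal{M}\to\mathcal{M}$ is the unique map with $\int\varphi\,d(\mathcal{L}^*\mu)=\int\mathcal{L}\varphi\,d\mu$ for all $\varphi\in C^0(X,\mathbb{C})$ and $\mu\in\mathcal{M}$;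 ${\mathcal{L}^*}^p$ is its $p$-th iterate. For each $x\in X$, $P(x,\cdot)\in\mathcal{M}$ denotes the unique probability measure with $(\mathcal{L}\varphi)(x)=\int\varphi(y)\,P(x,dy)$ for all $\varphi\in C^0(X,\mathbb{C})$. $L_\infty$ denotes the set of bounded functions $\varphi:X\to\mathbb{C}$ such that for every $\mu\in\mathcal{M}$ there is a (Borel) measurable function $\varphi_\mu$ that coincides with $\varphi$ $\mu$-a.e.; one puts $\int\varphi\,d\mu:=\int\varphi_\mu\,d\mu$. The operator $\mathcal{L}$ is extended to $L_\infty$ by $(\mathcal{L}\varphi)(x):=\int\varphi(y)\,P(x,dy)$ for all $x\in X$, $\varphi\in L_\infty$; it maps $L_\infty$ to itself. $\mathcal{L}^j$ is the $j$-th iterate of this extended operator ($\mathcal{L}^0$ is the identity). A set $A\in\mathcal{A}$ is $\mu$-a.e. $\mathcal{L}^p$-invariant if $\mathcal{L}^p\chi_A=\chi_A$ $\mu$-a.e., where $\chi_A$ is the characteristic function of $A$. The measure $\mu$ is ergodic for ${\mathcal{L}^*}^p$ if ${\mathcal{L}^*}^p\mu=\mu$ and $\mu(A)\in\{0,1\}$ for every set $A\in\mathcal{A}$ that is $\mu$-a.e. $\mathcal{L}^p$-invariant. *)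

theory Defs
  imports "HOL-Probability.Probability" "HOL-Library.Nonpos_Ints"
begin

text \<open>
  The compact metric space \<open>X\<close> is rendered as a type \<open>'a :: metric_space\<close> with \<open>compact UNIV\<close>
  (assumed in the theorem).  Under this assumption every continuous function is bounded, so
  \<open>'a \<Rightarrow>\<^sub>C complex\<close> is the space of all continuous complex functions, with the supremum norm.
\<close>

text \<open>The library only provides real scalar multiplication on \<open>'a \<Rightarrow>\<^sub>C complex\<close>.\<close>

definition cscale_bcontfun ::
  "complex \<Rightarrow> ('a::topological_space \<Rightarrow>\<^sub>C complex) \<Rightarrow> ('a \<Rightarrow>\<^sub>C complex)" where
  "cscale_bcontfun c \<phi> = Bcontfun (\<lambda>x. c * apply_bcontfun \<phi> x)"

lemma apply_cscale_bcontfun [simp]: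
  "apply_bcontfun (cscale_bcontfun c \<phi>) x = c * apply_bcontfun \<phi> x"
proof -
  have "(\<lambda>x. c * apply_bcontfun \<phi> x) \<in> bcontfun"
    by (rule bcontfun_normI[where b = "norm c * norm \<phi>"])
       (auto intro!: continuous_intros mult_left_mono norm_bounded simp: norm_mult)
  then show ?thesis
    by (simp add: cscale_bcontfun_def Bcontfun_inverse)
qed

definition transfer_operator ::
  "(('a::metric_space \<Rightarrow>\<^sub>C complex) \<Rightarrow> ('a \<Rightarrow>\<^sub>C complex)) \<Rightarrow> bool" where
  "transfer_operator L \<longleftrightarrow>
     (\<forall>\<phi> \<psi>. L (\<phi> + \<psi>) = L \<phi> + L \<psi>) \<and>
     (\<forall>c \<phi>. L (cscale_bcontfun c \<phi>) = cscale_bcontfun c (L \<phi>)) \<and>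
     (\<forall>\<phi>. (\<forall>x. apply_bcontfun \<phi> x \<in> \<real>\<^sub>\<ge>\<^sub>0) \<longrightarrow> (\<forall>x. apply_bcontfun (L \<phi>) x \<in> \<real>\<^sub>\<ge>\<^sub>0)) \<and>
     (\<forall>\<phi>. norm (L \<phi>) \<le> norm \<phi>) \<and>
     L (const_bcontfun 1) = const_bcontfun 1"

definition prob_measures :: "'a::topological_space measure set" where
  "prob_measures = {\<mu>. prob_space \<mu> \<and> sets \<mu> = sets borel}"

text \<open>
  The next two objects exist and are unique, for a transfer operator on a compact space and
  \<open>\<mu> \<in> prob_measures\<close>, by the Riesz representation theorem.
\<close>

definition dual_operator ::
  "(('a::metric_space \<Rightarrow>\<^sub>C complex) \<Rightarrow> ('a \<Rightarrow>\<^sub>C complex)) \<Rightarrow> 'a measure \<Rightarrow> 'a measure" where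
  "dual_operator L \<mu> = (THE \<nu>. \<nu> \<in> prob_measures \<and>
     (\<forall>\<phi>. (\<integral>x. apply_bcontfun \<phi> x \<partial>\<nu>) = (\<integral>x. apply_bcontfun (L \<phi>) x \<partial>\<mu>)))"

definition transition_prob ::
  "(('a::metric_space \<Rightarrow>\<^sub>C complex) \<Rightarrow> ('a \<Rightarrow>\<^sub>C complex)) \<Rightarrow> 'a \<Rightarrow> 'a measure" where
  "transition_prob L x = (THE \<nu>. \<nu> \<in> prob_measures \<and>
     (\<forall>\<phi>. apply_bcontfun (L \<phi>) x = (\<integral>y. apply_bcontfun \<phi> y \<partial>\<nu>)))"

definition L_infty :: "('a::topological_space \<Rightarrow> complex) set" where
  "L_infty = {\<phi>. bounded (range \<phi>) \<and>
     (\<forall>\<mu>\<in>prob_measures. \<exists>\<psi>\<in>borel_measurable borel. AE x in \<mu>. \<phi> x = \<psi> x)}"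

text \<open>
  A function in \<open>L_infty\<close> need not be Borel measurable, so its integral is that of a Borel
  measurable representative; the value does not depend on the representative chosen.
\<close>

definition L_infty_integral :: "'a::topological_space measure \<Rightarrow> ('a \<Rightarrow> complex) \<Rightarrow> complex" where
  "L_infty_integral \<mu> \<phi> =
     (\<integral>x. (SOME \<psi>. \<psi> \<in> borel_measurable borel \<and> (AE y in \<mu>. \<phi> y = \<psi> y)) x \<partial>\<mu>)"

definition extended_operator ::
  "(('a::metric_space \<Rightarrow>\<^sub>C complex) \<Rightarrow> ('a \<Rightarrow>\<^sub>C complex)) \<Rightarrow> ('a \<Rightarrow> complex) \<Rightarrow> ('a \<Rightarrow> complex)" where
  "extended_operator L \<phi> x = L_infty_integral (transition_prob L x) \<phi>"

definition ae_invariant ::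
  "(('a::metric_space \<Rightarrow>\<^sub>C complex) \<Rightarrow> ('a \<Rightarrow>\<^sub>C complex)) \<Rightarrow> nat \<Rightarrow> 'a measure \<Rightarrow> 'a set \<Rightarrow> bool" where
  "ae_invariant L p \<mu> A \<longleftrightarrow>
     (AE x in \<mu>. (extended_operator L ^^ p) (indicator A) x = indicator A x)"

definition ergodic_dual ::
  "(('a::metric_space \<Rightarrow>\<^sub>C complex) \<Rightarrow> ('a \<Rightarrow>\<^sub>C complex)) \<Rightarrow> nat \<Rightarrow> 'a measure \<Rightarrow> bool" where
  "ergodic_dual L p \<mu> \<longleftrightarrow>
     (dual_operator L ^^ p) \<mu> = \<mu> \<and>
     (\<forall>A\<in>sets borel. ae_invariant L p \<mu> A \<longrightarrow> measure \<mu> A \<in> {0, 1})"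

definition birkhoff_average ::
  "(('a::metric_space \<Rightarrow>\<^sub>C complex) \<Rightarrow> ('a \<Rightarrow>\<^sub>C complex)) \<Rightarrow> nat \<Rightarrow> ('a \<Rightarrow> complex) \<Rightarrow> nat \<Rightarrow> 'a \<Rightarrow> complex" where
  "birkhoff_average L p \<phi> n x =
     (1 / of_nat n) * (\<Sum>j<n. (extended_operator L ^^ (j * p)) \<phi> x)"

definition birkhoff_limit ::
  "(('a::metric_space \<Rightarrow>\<^sub>C complex) \<Rightarrow> ('a \<Rightarrow>\<^sub>C complex)) \<Rightarrow> nat \<Rightarrow> ('a \<Rightarrow> complex) \<Rightarrow> 'a \<Rightarrow> complex" where
  "birkhoff_limit L p \<phi> x = lim (\<lambda>n. birkhoff_average L p \<phi> n x)"

end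

theory Submission
  imports Defs
begin

text \<open>
  A transfer operator is integration against a Markov kernel. For each \<open>x\<close> the functional
  \<open>\<phi> \<mapsto> (L \<phi>)(x)\<close> is positive and normalised, hence by the Riesz theorem (\<open>Riesz_representation\<close>) it is
  integration against a unique probability measure \<open>P(x, \<cdot>)\<close>; this measure depends measurably on \<open>x\<close>, because
  the mass of a closed set is a pointwise limit of functions \<open>L \<phi>\<close>. The dual operator is
  \<open>\<nu> \<mapsto> \<nu> \<bind> P\<close>, the iterates of \<open>L\<close> on bounded universally measurable functions are
  integrations against the iterated kernels, and \<open>\<mu>\<close> is fixed by the \<open>p\<close>-th dual iterate exactly
  when it is stationary for the \<open>p\<close>-step kernel \<open>K\<close>. Replacing \<open>\<phi>\<close> by a Borel representative
  changes the averages only on a \<open>\<mu>\<close>-null set, again because \<open>\<mu>\<close> is stationary. The claim is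
  thus the pointwise ergodic theorem for \<open>K\<close> (\<open>pointwise_ergodic\<close>), applied to the real and imaginary parts of the
  representative.

  For the ergodic theorem write \<open>T f (x) = \<integral> f dK(x, \<cdot>)\<close>, and let \<open>h\<close> be the upper limit of the
  averages of a bounded function \<open>f\<close>. Dominated convergence gives \<open>h \<le> T h\<close>, and since
  \<open>\<integral> T h d\<mu> = \<integral> h d\<mu>\<close>, the function \<open>h\<close> is invariant almost everywhere. The ergodic sums of
  \<open>f - h + \<epsilon>\<close> are therefore those of \<open>f\<close> minus \<open>n (h - \<epsilon>)\<close>, and at almost every point at least one
  of them is positive. Hopf's maximal ergodic lemma (\<open>maximal_ergodic\<close>) yields \<open>\<integral> f d\<mu> - \<integral> h d\<mu> + \<epsilon> \<ge> 0\<close>. Hence the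
  upper limit has integral at most \<open>\<integral> f d\<mu>\<close>. The same argument for \<open>- f\<close> shows that the lower
  limit has integral at least \<open>\<integral> f d\<mu>\<close>, so the two coincide almost everywhere.

  If \<open>h\<close> is invariant, the variance-type integral
  \<open>\<integral>\<integral> (h(y) - h(x))\<^sup>2 K(x, dy) \<mu>(dx) = 2 \<integral> h\<^sup>2 d\<mu> - 2 \<integral> h (T h) d\<mu>\<close> vanishes, so almost surely the
  kernel moves \<open>x\<close> inside the level set of \<open>h\<close> through \<open>x\<close> (\<open>AE_kernel_constant\<close>). The set where \<open>h\<close> exceeds its mean is
  then an invariant set. Under ergodicity its measure is \<open>0\<close> or \<open>1\<close>, the latter is absurd, and so
  \<open>h\<close> is constant, equal to \<open>\<integral> f d\<mu>\<close>.
\<close>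

section \<open>The Riesz representation theorem on a compact metric space\<close>

text \<open>
  Continuous functions decreasing to the indicator of a nonempty closed set: they let positive
  functionals and integrals of continuous functions see closed sets.
\<close>

definition cutoff :: "'a::metric_space set \<Rightarrow> nat \<Rightarrow> 'a \<Rightarrow> real" where
  "cutoff F k x = max 0 (1 - real k * infdist x F)"

lemma continuous_cutoff: "continuous_on UNIV (cutoff F k)"
  unfolding cutoff_def [abs_def] by (intro continuous_intros)

lemma cutoff_nonneg: "0 \<le> cutoff F k x"
  by (simp add: cutoff_def)

lemma cutoff_le_1: "cutoff F k x \<le> 1"
  by (simp add: cutoff_def infdist_nonneg)

lemma cutoff_0: "cutoff F 0 x = 1"
  by (simp add: cutoff_def)

lemma cutoff_eq_1: "x \<in> F \<Longrightarrow> cutoff F k x = 1"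
  by (simp add: cutoff_def)

lemma cutoff_Suc_le: "cutoff F (Suc k) x \<le> cutoff F k x"
  using infdist_nonneg[of x F] by (auto simp: cutoff_def algebra_simps max_def)

lemma cutoff_LIMSEQ:
  assumes "closed F" "F \<noteq> {}"
  shows "(\<lambda>k. cutoff F k x) \<longlonglongrightarrow> indicator F x"
proof (cases "x \<in> F")
  case False
  have pos: "infdist x F > 0"
    using False assms in_closed_iff_infdist_zero[of F x] infdist_nonneg[of x F] by auto
  obtain N :: nat where N: "1 / infdist x F \<le> real N"
    using real_arch_simple by blast
  have "cutoff F k x = 0" if "N \<le> k" for k
  proof -
    have "1 / infdist x F \<le> real k" using N that by linarith
    then have "1 \<le> real k * infdist x F" using pos by (simp add: field_simps)
    then show ?thesis by (simp add: cutoff_def)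
  qed
  then show ?thesis
    using False by (intro tendsto_eventually) (auto simp: eventually_sequentially)
qed (simp add: cutoff_eq_1)

text \<open>
  The layer-cake decomposition: \<open>t\<close> is cut into slices of height one.
\<close>

lemma sum_unit_layers:
  fixes t :: real and N :: nat
  assumes "0 \<le> t"
  shows "(\<Sum>i<N. max 0 (min 1 (t - real i))) = min t (real N)"
  using assms by (induction N) (auto simp: min_def max_def)

locale normalised_positive_functional =
  fixes \<Lambda> :: "('a::metric_space \<Rightarrow> real) \<Rightarrow> real"
  assumes add: "continuous_on UNIV f \<Longrightarrow> continuous_on UNIV g \<Longrightarrow> \<Lambda> (\<lambda>x. f x + g x) = \<Lambda> f + \<Lambda> g"
    and scale: "continuous_on UNIV f \<Longrightarrow> \<Lambda> (\<lambda>x. c * f x) = c * \<Lambda> f"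
    and nonneg: "continuous_on UNIV f \<Longrightarrow> (\<And>x. 0 \<le> f x) \<Longrightarrow> 0 \<le> \<Lambda> f"
    and one: "\<Lambda> (\<lambda>_. 1) = 1"
begin

lemma zero: "\<Lambda> (\<lambda>_. 0) = 0"
  using scale[of "\<lambda>_. 0" 0] by simp

lemma diff:
  assumes "continuous_on UNIV f" "continuous_on UNIV g"
  shows "\<Lambda> (\<lambda>x. f x - g x) = \<Lambda> f - \<Lambda> g"
  using add[of f "\<lambda>x. (-1) * g x"] scale[of g "-1"] assms
  by (simp add: continuous_on_minus)

lemma mono:
  assumes "continuous_on UNIV f" "continuous_on UNIV g" "\<And>x. f x \<le> g x"
  shows "\<Lambda> f \<le> \<Lambda> g"
  using nonneg[of "\<lambda>x. g x - f x"] diff[of g f] assms by (simp add: continuous_on_diff)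

lemma sum:
  assumes "finite I" "\<And>i. i \<in> I \<Longrightarrow> continuous_on UNIV (f i)"
  shows "\<Lambda> (\<lambda>x. \<Sum>i\<in>I. f i x) = (\<Sum>i\<in>I. \<Lambda> (f i))"
  using assms
proof (induction I rule: finite_induct)
  case empty
  then show ?case by (simp add: zero)
next
  case (insert i I)
  then show ?case by (simp add: add continuous_on_sum)
qed

text \<open>
  Sequences of nonnegative continuous functions whose sum dominates the indicator of \<open>A\<close>. The
  sum is taken in \<open>ennreal\<close>, so that it may diverge.
\<close>

definition cover :: "'a set \<Rightarrow> (nat \<Rightarrow> 'a \<Rightarrow> real) \<Rightarrow> bool" where
  "cover A f \<longleftrightarrow> (\<forall>n. continuous_on UNIV (f n)) \<and> (\<forall>n x. 0 \<le> f n x) \<and>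
     (\<forall>x\<in>A. 1 \<le> (\<Sum>n. ennreal (f n x)))"

text \<open>
  Covering by functions instead of by open sets makes monotonicity and countable subadditivity
  immediate, and a function that covers a set can be multiplied by a cutoff in order to cover a
  part of it.
\<close>

definition outer :: "'a set \<Rightarrow> ennreal" where
  "outer A = (INF f\<in>Collect (cover A). \<Sum>n. ennreal (\<Lambda> (f n)))"

lemma outer_le: "cover A f \<Longrightarrow> outer A \<le> (\<Sum>n. ennreal (\<Lambda> (f n)))"
  unfolding outer_def by (rule INF_lower) simp

lemma outer_mono: "A \<subseteq> B \<Longrightarrow> outer A \<le> outer B"
  unfolding outer_def by (rule INF_superset_mono) (simp_all add: cover_def Collect_mono_iff subset_iff)

lemma outer_le_single:
  assumes "continuous_on UNIV f" "\<And>x. 0 \<le> f x" "\<And>x. x \<in> A \<Longrightarrow> 1 \<le> f x"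
  shows "outer A \<le> ennreal (\<Lambda> f)"
proof -
  let ?f = "\<lambda>n::nat. if n = 0 then f else (\<lambda>_. 0)"
  have "(\<Sum>n. ennreal (?f n x)) = ennreal (f x)" for x
    by (subst suminf_finite[of "{0}"]) auto
  then have "cover A ?f"
    using assms unfolding cover_def by (auto simp: ennreal_ge_1)
  then have "outer A \<le> (\<Sum>n. ennreal (\<Lambda> (?f n)))"
    by (rule outer_le)
  also have "\<dots> = ennreal (\<Lambda> f)"
    by (subst suminf_finite[of "{0}"]) (auto simp: zero)
  finally show ?thesis .
qed

lemma outer_le_double:
  assumes "\<And>k n. continuous_on UNIV (g k n)" "\<And>k n x. 0 \<le> g k n x"
    and "\<And>x. x \<in> A \<Longrightarrow> 1 \<le> (\<Sum>k. \<Sum>n. ennreal (g k n x))"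
  shows "outer A \<le> (\<Sum>k. \<Sum>n. ennreal (\<Lambda> (g k n)))"
proof -
  let ?h = "\<lambda>i. case_prod g (prod_decode i)"
  have eq: "(\<Sum>i. ennreal (?h i x)) = (\<Sum>k. \<Sum>n. ennreal (g k n x))" for x
    using suminf_ennreal_2dimen[of "\<lambda>k. \<Sum>n. ennreal (g k n x)" "\<lambda>(k, n). ennreal (g k n x)"]
    by (simp add: split_def)
  have "cover A ?h"
    unfolding cover_def eq using assms by (auto simp: split_def)
  then have "outer A \<le> (\<Sum>i. ennreal (\<Lambda> (?h i)))"
    by (rule outer_le)
  also have "\<dots> = (\<Sum>k. \<Sum>n. ennreal (\<Lambda> (g k n)))"
    using suminf_ennreal_2dimen[of "\<lambda>k. \<Sum>n. ennreal (\<Lambda> (g k n))" "\<lambda>(k, n). ennreal (\<Lambda> (g k n))"]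
    by (simp add: split_def)
  finally show ?thesis .
qed

lemma outer_countably_subadditive: "outer (\<Union>i. A i) \<le> (\<Sum>i. outer (A i))"
proof (rule ennreal_le_epsilon)
  fix e :: real assume "0 < e" and fin: "(\<Sum>i. outer (A i)) < top"
  have "\<exists>f. cover (A i) f \<and> (\<Sum>n. ennreal (\<Lambda> (f n))) \<le> outer (A i) + e * (1/2) ^ Suc i" for i
  proof -
    have "outer (A i) < top"
      using fin ennreal_suminf_lessD by blast
    moreover have "0 < e * (1/2) ^ Suc i"
      using \<open>0 < e\<close> by simp
    ultimately have "\<exists>f\<in>Collect (cover (A i)). (\<Sum>n. ennreal (\<Lambda> (f n))) < outer (A i) + e * (1/2) ^ Suc i"
      by (intro INF_approx_ennreal[OF _ outer_def]) auto
    then show ?thesis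
      by (auto intro: less_imp_le)
  qed
  then obtain f where f: "\<And>i. cover (A i) (f i)"
    and le: "\<And>i. (\<Sum>n. ennreal (\<Lambda> (f i n))) \<le> outer (A i) + e * (1/2) ^ Suc i"
    by metis
  have "outer (\<Union>i. A i) \<le> (\<Sum>i. \<Sum>n. ennreal (\<Lambda> (f i n)))"
  proof (rule outer_le_double)
    fix x assume "x \<in> (\<Union>i. A i)"
    then obtain i where "x \<in> A i" by auto
    then have "1 \<le> (\<Sum>n. ennreal (f i n x))"
      using f by (auto simp: cover_def)
    also have "\<dots> \<le> (\<Sum>i. \<Sum>n. ennreal (f i n x))"
      using sum_le_suminf[of "\<lambda>i. \<Sum>n. ennreal (f i n x)" "{i}"] by simp
    finally show "1 \<le> (\<Sum>i. \<Sum>n. ennreal (f i n x))" .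
  qed (use f in \<open>auto simp: cover_def\<close>)
  also have "\<dots> \<le> (\<Sum>i. outer (A i) + ennreal (e * (1/2) ^ Suc i))"
    using le by (intro suminf_le) auto
  also have "\<dots> = (\<Sum>i. outer (A i)) + (\<Sum>i. ennreal e * ennreal ((1/2) ^ Suc i))"
    using \<open>0 < e\<close> by (subst suminf_add[symmetric])
      (auto simp del: ennreal_suminf_cmult simp add: ennreal_mult[symmetric])
  also have "\<dots> = (\<Sum>i. outer (A i)) + ennreal e"
    unfolding ennreal_suminf_cmult
    by (subst suminf_ennreal_eq[OF zero_le_power power_half_series]) auto
  finally show "outer (\<Union>i. A i) \<le> (\<Sum>i. outer (A i)) + ennreal e" .
qed

lemma outer_empty: "outer {} = 0"
  using outer_le_single[of "\<lambda>_. 0" "{}"] by (simp add: zero)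

lemma outer_measure_space_outer: "outer_measure_space UNIV outer"
  unfolding outer_measure_space_def
  by (auto simp: positive_def increasing_def countably_subadditive_def outer_empty
      intro: outer_mono outer_countably_subadditive)

text \<open>
  With \<open>u\<^sub>k\<close> the cutoffs of \<open>F\<close>, a cover \<open>f\<close> of \<open>A\<close> splits into the cover \<open>f\<^sub>n u\<^sub>K\<close> of \<open>A \<inter> F\<close> and
  the functions \<open>f\<^sub>n (u\<^sub>k - u\<^sub>k\<^sub>+\<^sub>1)\<close> with \<open>k < K\<close>. The latter cover \<open>A - F\<close> once all \<open>k\<close> are allowed,
  since off \<open>F\<close> the cutoffs tend to zero. For each \<open>K\<close> the two costs add up to the cost of \<open>f\<close>, so
  \<open>F\<close> satisfies Caratheodory's criterion.
\<close>

lemma outer_split_closed: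
  assumes "closed F" "F \<noteq> {}"
  shows "outer (A \<inter> F) + outer (A - F) \<le> outer A"
proof -
  define u where "u = cutoff F"
  define w where "w = (\<lambda>k x. u k x - u (Suc k) x)"
  have u_cont: "continuous_on UNIV (u k)" for k
    unfolding u_def by (rule continuous_cutoff)
  have u_nonneg: "0 \<le> u k x" for k x by (simp add: u_def cutoff_nonneg)
  have u0: "u 0 x = 1" for x by (simp add: u_def cutoff_0)
  have u_F: "u k x = 1" if "x \<in> F" for k x using that by (simp add: u_def cutoff_eq_1)
  have w_cont: "continuous_on UNIV (w k)" for k
    unfolding w_def by (intro continuous_intros u_cont)
  have w_nonneg: "0 \<le> w k x" for k x
    by (simp add: w_def u_def cutoff_Suc_le)
  have w_sum: "(\<Sum>k<K. w k x) = 1 - u K x" for K x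
    unfolding w_def by (subst sum_lessThan_telescope') (simp add: u0)
  have w_sums: "(\<Sum>k. ennreal (w k x)) = 1" if "x \<notin> F" for x
  proof -
    have "(\<lambda>K. u K x) \<longlonglongrightarrow> 0"
      using cutoff_LIMSEQ[OF assms, of x] that by (simp add: u_def)
    then have "(\<lambda>k. w k x) sums (1 - 0)"
      unfolding sums_def w_sum by (intro tendsto_intros)
    then have "(\<Sum>k. ennreal (w k x)) = ennreal (1 - 0)"
      by (rule suminf_ennreal_eq[OF w_nonneg])
    then show ?thesis by simp
  qed
  show ?thesis
    unfolding outer_def[of A]
  proof (rule INF_greatest)
    fix f assume "f \<in> Collect (cover A)"
    then have cont: "\<And>n. continuous_on UNIV (f n)" and nn: "\<And>n x. 0 \<le> f n x"
      and cov: "\<And>x. x \<in> A \<Longrightarrow> 1 \<le> (\<Sum>n. ennreal (f n x))"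
      unfolding cover_def by blast+
    have cw: "continuous_on UNIV (\<lambda>x. f n x * w k x)" for n k
      by (intro continuous_intros cont w_cont)
    have cu: "continuous_on UNIV (\<lambda>x. f n x * u k x)" for n k
      by (intro continuous_intros cont u_cont)
    have "outer (A - F) \<le> (\<Sum>k. \<Sum>n. ennreal (\<Lambda> (\<lambda>x. f n x * w k x)))"
    proof (rule outer_le_double)
      fix x assume x: "x \<in> A - F"
      have "(\<Sum>k. \<Sum>n. ennreal (f n x * w k x)) = (\<Sum>k. (\<Sum>n. ennreal (f n x)) * ennreal (w k x))"
        using nn w_nonneg by (simp add: ennreal_mult)
      also have "\<dots> = (\<Sum>n. ennreal (f n x))"
        using x w_sums by simp
      finally show "1 \<le> (\<Sum>k. \<Sum>n. ennreal (f n x * w k x))"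
        using cov x by simp
    qed (use cw nn w_nonneg in auto)
    moreover have "(\<Sum>k. \<Sum>n. ennreal (\<Lambda> (\<lambda>x. f n x * w k x))) + outer (A \<inter> F)
        \<le> (\<Sum>n. ennreal (\<Lambda> (f n)))"
    proof (rule ennreal_suminf_bound_add)
      fix K
      have "outer (A \<inter> F) \<le> (\<Sum>n. ennreal (\<Lambda> (\<lambda>x. f n x * u K x)))"
        by (rule outer_le) (use cu nn u_nonneg cov u_F in \<open>auto simp: cover_def\<close>)
      then have "(\<Sum>k<K. \<Sum>n. ennreal (\<Lambda> (\<lambda>x. f n x * w k x))) + outer (A \<inter> F)
          \<le> (\<Sum>k<K. \<Sum>n. ennreal (\<Lambda> (\<lambda>x. f n x * w k x)))
            + (\<Sum>n. ennreal (\<Lambda> (\<lambda>x. f n x * u K x)))"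
        by (rule add_left_mono)
      also have "\<dots> = (\<Sum>n. (\<Sum>k<K. ennreal (\<Lambda> (\<lambda>x. f n x * w k x)))
            + ennreal (\<Lambda> (\<lambda>x. f n x * u K x)))"
        by (simp only: suminf_sum[OF summableI, symmetric] suminf_add[OF summableI summableI])
      also have "\<dots> = (\<Sum>n. ennreal (\<Lambda> (f n)))"
      proof (intro suminf_cong)
        fix n
        have "(\<Sum>k<K. ennreal (\<Lambda> (\<lambda>x. f n x * w k x))) + ennreal (\<Lambda> (\<lambda>x. f n x * u K x))
          = ennreal ((\<Sum>k<K. \<Lambda> (\<lambda>x. f n x * w k x)) + \<Lambda> (\<lambda>x. f n x * u K x))"
          using nonneg[OF cw, of n] nonneg[OF cu, of n K] nn w_nonneg u_nonneg
          by (simp add: ennreal_plus sum_nonneg sum_ennreal)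
        also have "(\<Sum>k<K. \<Lambda> (\<lambda>x. f n x * w k x)) + \<Lambda> (\<lambda>x. f n x * u K x)
          = \<Lambda> (\<lambda>x. (\<Sum>k<K. f n x * w k x) + f n x * u K x)"
          using cw cu by (simp add: add sum continuous_on_sum)
        also have "(\<lambda>x. (\<Sum>k<K. f n x * w k x) + f n x * u K x) = f n"
          by (simp add: sum_distrib_left[symmetric] w_sum algebra_simps)
        finally show "(\<Sum>k<K. ennreal (\<Lambda> (\<lambda>x. f n x * w k x)))
          + ennreal (\<Lambda> (\<lambda>x. f n x * u K x)) = ennreal (\<Lambda> (f n))" .
      qed
      finally show "(\<Sum>k<K. \<Sum>n. ennreal (\<Lambda> (\<lambda>x. f n x * w k x))) + outer (A \<inter> F)
        \<le> (\<Sum>n. ennreal (\<Lambda> (f n)))" .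
    qed
    ultimately show "outer (A \<inter> F) + outer (A - F) \<le> (\<Sum>n. ennreal (\<Lambda> (f n)))"
      unfolding add.commute[of "outer (A \<inter> F)"] by (rule order_trans[OF add_right_mono])
  qed
qed

definition rep_measure :: "'a measure" where
  "rep_measure = measure_of UNIV (sets borel) outer"

lemma sets_rep_measure [simp, measurable_cong]: "sets rep_measure = sets borel"
  unfolding rep_measure_def by (metis sets_measure_of_conv sets.sigma_sets_eq space_borel sets.space_closed top_greatest Pow_UNIV)

lemma space_rep_measure [simp]: "space rep_measure = UNIV"
  using sets_eq_imp_space_eq[OF sets_rep_measure] by simp

lemma emeasure_rep_measure:
  assumes "A \<in> sets borel"
  shows "emeasure rep_measure A = outer A"
proof -
  interpret P: sigma_algebra UNIV "UNIV :: 'a set set"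
    using sigma_algebra_Pow[of "UNIV :: 'a set"] by simp
  let ?S = "lambda_system UNIV UNIV outer"
  have ms: "measure_space UNIV ?S outer"
    by (rule P.caratheodory_lemma[OF outer_measure_space_outer])
  then interpret S: sigma_algebra UNIV ?S
    by (simp add: measure_space_def)
  have "F \<in> ?S" if "closed F" for F
  proof (cases "F = {}")
    case False
    have "outer B \<le> outer (B \<inter> F) + outer (B - F)" for B
    proof -
      have "subadditive UNIV outer"
        using outer_measure_space_outer P.countably_subadditive_subadditive
        by (simp add: outer_measure_space_def)
      then have "outer ((B \<inter> F) \<union> (B - F)) \<le> outer (B \<inter> F) + outer (B - F)"
        by (rule subadditiveD) auto
      then show ?thesis by (simp add: Int_Diff_Un)
    qed
    then show ?thesis
      unfolding P.lambda_system_eq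
      using outer_split_closed[OF that False] by (auto intro: antisym)
  qed (simp)
  then have "sigma_sets UNIV (Collect closed) \<subseteq> ?S"
    by (intro S.sigma_sets_subset) auto
  then have sub: "sets borel \<subseteq> ?S"
    by (simp add: borel_eq_closed)
  show ?thesis
    unfolding rep_measure_def
  proof (rule emeasure_measure_of_sigma)
    show "sigma_algebra UNIV (sets (borel :: 'a measure))"
      using sets.sigma_algebra_axioms[of "borel :: 'a measure"] by simp
    show "positive (sets borel) outer"
      by (simp add: positive_def outer_empty)
    show "countably_additive (sets borel) outer"
      using ms sub unfolding measure_space_def countably_additive_def
      by (meson subset_trans subsetD)
  qed fact
qed

lemma measurable_rep_measure:
  "continuous_on UNIV (f :: 'a \<Rightarrow> real) \<Longrightarrow> f \<in> borel_measurable rep_measure"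
  by (simp add: borel_measurable_continuous_onI cong: measurable_cong_sets)

lemma rep_measure_le:
  assumes "A \<in> sets borel" "continuous_on UNIV f" "\<And>x. 0 \<le> f x" "\<And>x. x \<in> A \<Longrightarrow> 1 \<le> f x"
  shows "measure rep_measure A \<le> \<Lambda> f"
  using outer_le_single[of f A] assms nonneg[of f]
  by (simp add: measure_def emeasure_rep_measure enn2real_leI)

text \<open>
  Compactness provides continuity of the functional along monotone sequences: if the functions
  \<open>f\<^sub>n\<close> sum to at least one everywhere, then some finite partial sum
  exceeds \<open>1 - e\<close> everywhere, so the cost of the cover is at least \<open>1 - e\<close>.
\<close>

lemma outer_UNIV:
  assumes "compact (UNIV :: 'a set)"
  shows "outer UNIV = 1"
proof (rule antisym)
  show "outer UNIV \<le> 1"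
    using outer_le_single[of "\<lambda>_. 1" UNIV] by (simp add: one)
  show "1 \<le> outer UNIV"
    unfolding outer_def
  proof (rule INF_greatest)
    fix f assume "f \<in> Collect (cover UNIV)"
    then have cont: "\<And>n. continuous_on UNIV (f n)" and nn: "\<And>n x. 0 \<le> f n x"
      and cov: "\<And>x. 1 \<le> (\<Sum>n. ennreal (f n x))"
      unfolding cover_def by blast+
    have cs: "continuous_on UNIV (\<lambda>x. \<Sum>n<N. f n x)" for N
      by (intro continuous_intros cont)
    show "1 \<le> (\<Sum>n. ennreal (\<Lambda> (f n)))"
    proof (rule ennreal_le_epsilon)
      fix e :: real assume e: "0 < e"
      define U where "U N = {x. 1 - e < (\<Sum>n<N. f n x)}" for N
      have "open (U N)" for N
        unfolding U_def by (intro open_Collect_less continuous_on_const cs)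
      moreover have "UNIV \<subseteq> (\<Union>N. U N)"
      proof
        fix x :: 'a
        have "ennreal (1 - e) < (\<Sum>n. ennreal (f n x))"
          using cov[of x] e
          by (intro less_le_trans[OF _ cov]) (simp add: ennreal_less_one_iff)
        then obtain N where "ennreal (1 - e) < (\<Sum>n<N. ennreal (f n x))"
          unfolding suminf_eq_SUP less_SUP_iff by auto
        then have "ennreal (1 - e) < ennreal (\<Sum>n<N. f n x)"
          using nn by simp
        then have "x \<in> U N"
          unfolding U_def mem_Collect_eq by (meson ennreal_leI not_le)
        then show "x \<in> (\<Union>N. U N)" by auto
      qed
      ultimately obtain C where C: "finite C" "UNIV \<subseteq> (\<Union>N\<in>C. U N)"
        using compactE_image[OF assms, of UNIV U] by auto
      define N where "N = Max (insert 0 C)"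
      have ge: "1 - e \<le> (\<Sum>n<N. f n x)" for x
      proof -
        obtain M where M: "M \<in> C" "x \<in> U M" using C(2) by auto
        then have "M \<le> N" using C(1) by (simp add: N_def)
        then have "(\<Sum>n<M. f n x) \<le> (\<Sum>n<N. f n x)"
          using nn by (intro sum_mono2) auto
        then show ?thesis using M(2) by (simp add: U_def)
      qed
      have "1 - e = \<Lambda> (\<lambda>_. (1 - e) * 1)"
        using scale[of "\<lambda>_. 1" "1 - e"] by (simp add: one)
      also have "\<dots> \<le> \<Lambda> (\<lambda>x. \<Sum>n<N. f n x)"
        using ge cs by (intro mono) auto
      also have "\<dots> = (\<Sum>n<N. \<Lambda> (f n))"
        using cont by (intro sum) auto
      finally have "1 \<le> (\<Sum>n<N. \<Lambda> (f n)) + e" by simp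
      then have "1 \<le> ennreal ((\<Sum>n<N. \<Lambda> (f n)) + e)"
        by (simp add: ennreal_ge_1)
      also have "\<dots> = (\<Sum>n<N. ennreal (\<Lambda> (f n))) + ennreal e"
        using e nonneg[OF cont nn] by (simp add: ennreal_plus sum_nonneg sum_ennreal)
      also have "\<dots> \<le> (\<Sum>n. ennreal (\<Lambda> (f n))) + ennreal e"
        by (intro add_right_mono sum_le_suminf) auto
      finally show "1 \<le> (\<Sum>n. ennreal (\<Lambda> (f n))) + ennreal e" .
    qed
  qed
qed

lemma prob_space_rep_measure: "compact (UNIV :: 'a set) \<Longrightarrow> prob_space rep_measure"
  by (rule prob_spaceI) (simp add: emeasure_rep_measure outer_UNIV)

text \<open>
  Cutting \<open>f\<close> into \<open>N + 1\<close> slices, the measure of the set where \<open>f\<close> exceeds the top of a slice is at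
  most the functional of that slice, because the slice equals one there. The mass of the lowest
  level set contributes the error term \<open>1 / (N + 1)\<close>.
\<close>

lemma integral_rep_measure_le:
  assumes compact: "compact (UNIV :: 'a set)"
    and cont: "continuous_on UNIV f" and nn: "\<And>x. 0 \<le> f x" and le1: "\<And>x. f x \<le> 1"
  shows "(\<integral>x. f x \<partial>rep_measure) \<le> \<Lambda> f"
proof -
  interpret M: prob_space rep_measure
    by (rule prob_space_rep_measure[OF compact])
  have f_meas [measurable]: "f \<in> borel_measurable borel"
    using cont by (rule borel_measurable_continuous_onI)
  have int_f: "integrable rep_measure f"
    using nn le1 by (intro M.integrable_const_bound[where B = 1]) auto
  have bound: "real (Suc N) * (\<integral>x. f x \<partial>rep_measure) \<le> 1 + real (Suc N) * \<Lambda> f" for N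
  proof -
    define t where "t x = real (Suc N) * f x" for x
    define c where "c i x = max 0 (min 1 (t x - real i))" for i x
    define S where "S i = {x. real i < t x}" for i :: nat
    have t_cont: "continuous_on UNIV t"
      unfolding t_def by (intro continuous_intros cont)
    then have [measurable]: "t \<in> borel_measurable borel"
      by (rule borel_measurable_continuous_onI)
    have c_cont: "continuous_on UNIV (c i)" for i
      unfolding c_def by (intro continuous_intros t_cont)
    have S_sets [measurable]: "S i \<in> sets borel" for i
      unfolding S_def by measurable
    have t_le: "t x \<le> real (Suc N)" for x
      unfolding t_def using mult_left_mono[OF le1, of "real (Suc N)"] by simp
    have t_nn: "0 \<le> t x" for x unfolding t_def using nn by simp
    have c_sum: "(\<Sum>i<Suc N. c i x) = t x" for x
      unfolding c_def using sum_unit_layers[OF t_nn, where N = "Suc N"] t_le by (simp add: min_def)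
    have "real (Suc N) * (\<integral>x. f x \<partial>rep_measure) = (\<integral>x. t x \<partial>rep_measure)"
      unfolding t_def by simp
    also have "\<dots> \<le> (\<integral>x. (\<Sum>i<Suc N. indicator (S i) x) \<partial>rep_measure)"
    proof (rule integral_mono)
      show "integrable rep_measure t" unfolding t_def using int_f by simp
      show "integrable rep_measure (\<lambda>x. \<Sum>i<Suc N. indicator (S i) x :: real)"
        by (intro Bochner_Integration.integrable_sum integrable_real_indicator)
          (auto simp: M.emeasure_finite less_top[symmetric])
      show "t x \<le> (\<Sum>i<Suc N. indicator (S i) x)" for x
        unfolding c_sum[symmetric]
        by (intro sum_mono) (auto simp: c_def S_def indicator_def)
    qed
    also have "\<dots> = (\<Sum>i<Suc N. measure rep_measure (S i))"
      by (subst Bochner_Integration.integral_sum) (auto simp: less_top[symmetric])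
    also have "\<dots> = measure rep_measure (S 0) + (\<Sum>i<N. measure rep_measure (S (Suc i)))"
      by (rule sum.lessThan_Suc_shift)
    also have "\<dots> \<le> 1 + (\<Sum>i<N. \<Lambda> (c i))"
    proof (intro add_mono sum_mono)
      show "measure rep_measure (S (Suc i)) \<le> \<Lambda> (c i)" for i
        using S_sets c_cont by (rule rep_measure_le) (auto simp: c_def S_def)
    qed simp
    also have "\<dots> \<le> 1 + (\<Sum>i<Suc N. \<Lambda> (c i))"
      using nonneg[OF c_cont] by (simp add: c_def)
    also have "(\<Sum>i<Suc N. \<Lambda> (c i)) = \<Lambda> (\<lambda>x. \<Sum>i<Suc N. c i x)"
      using c_cont by (intro sum[symmetric]) auto
    also have "\<dots> = real (Suc N) * \<Lambda> f"
      unfolding c_sum t_def using cont by (rule scale)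
    finally show ?thesis .
  qed
  have "(\<integral>x. f x \<partial>rep_measure) - \<Lambda> f \<le> inverse (real (Suc N))" for N
    using bound[of N] by (simp add: field_simps)
  then have "(\<integral>x. f x \<partial>rep_measure) - \<Lambda> f \<le> 0"
    by (intro LIMSEQ_le_const[OF LIMSEQ_inverse_real_of_nat]) auto
  then show ?thesis by simp
qed

text \<open>
  For \<open>f\<close> with values in the unit interval the inequality \<open>\<integral> f \<le> \<Lambda> f\<close> holds for both \<open>f\<close> and
  \<open>1 - f\<close>; as the measure has total mass one, it is an equality. A general \<open>f\<close> is an affine image
  of such a function.
\<close>

theorem Riesz_representation:
  assumes compact: "compact (UNIV :: 'a set)" and cont: "continuous_on UNIV f"
  shows "(\<integral>x. f x \<partial>rep_measure) = \<Lambda> f"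
proof -
  interpret M: prob_space rep_measure
    by (rule prob_space_rep_measure[OF compact])
  have total: "measure rep_measure UNIV = 1"
    using M.prob_space by simp
  have unit: "(\<integral>x. g x \<partial>rep_measure) = \<Lambda> g"
    if g: "continuous_on UNIV g" "\<And>x. 0 \<le> g x" "\<And>x. g x \<le> 1" for g
  proof (rule antisym)
    have int: "integrable rep_measure g"
      using g by (intro M.integrable_const_bound[where B = 1])
        (auto intro: measurable_rep_measure)
    have "(\<integral>x. 1 - g x \<partial>rep_measure) \<le> \<Lambda> (\<lambda>x. 1 - g x)"
      using g by (intro integral_rep_measure_le compact continuous_intros) auto
    then show "\<Lambda> g \<le> (\<integral>x. g x \<partial>rep_measure)"
      using int g(1) diff[of "\<lambda>_. 1" g] by (simp add: one total)
  qed (use g in \<open>intro integral_rep_measure_le compact\<close>)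
  obtain B where B: "0 < B" "\<And>x. \<bar>f x\<bar> \<le> B"
    using compact_imp_bounded[OF compact_continuous_image[OF cont compact]]
    unfolding bounded_pos by auto
  define g where "g x = (f x + B) * (1 / (2 * B))" for x
  have f_eq: "f = (\<lambda>x. 2 * B * g x + (- B) * 1)"
    using B by (auto simp: g_def)
  have g: "continuous_on UNIV g" "\<And>x. 0 \<le> g x" "\<And>x. g x \<le> 1"
    using B by (auto simp: g_def abs_le_iff field_simps intro!: continuous_intros cont)
      (smt (verit) B)+
  have int: "integrable rep_measure g"
    using g by (intro M.integrable_const_bound[where B = 1])
      (auto intro: measurable_rep_measure)
  have "\<Lambda> f = 2 * B * \<Lambda> g + (- B) * \<Lambda> (\<lambda>_. 1)"
    using g(1) scale[of g "2 * B"] scale[of "\<lambda>_. 1" "- B"]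
    by (subst f_eq, subst add) (auto intro!: continuous_intros)
  also have "\<dots> = (\<integral>x. f x \<partial>rep_measure)"
    using int unit[OF g] by (subst f_eq) (simp add: one total)
  finally show ?thesis by simp
qed

end

section \<open>Integration against a composed kernel\<close>

lemma integral_bind_bounded:
  fixes f :: "'b \<Rightarrow> real"
  assumes M: "prob_space M" and K: "K \<in> M \<rightarrow>\<^sub>M prob_algebra N"
    and f: "f \<in> borel_measurable N" and B: "\<And>y. y \<in> space N \<Longrightarrow> \<bar>f y\<bar> \<le> B"
  shows "(\<integral>y. f y \<partial>(M \<bind> K)) = (\<integral>x. (\<integral>y. f y \<partial>K x) \<partial>M)"
proof -
  interpret prob_space M by fact
  have K': "K \<in> M \<rightarrow>\<^sub>M subprob_algebra N"
    using K by (rule measurable_prob_algebraD)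
  interpret D: prob_space "distr M (subprob_algebra N) K"
    using K' by (rule prob_space_distr)
  have "(\<integral>y. f y \<partial>(M \<bind> K)) = (\<integral>M'. integral\<^sup>L M' f \<partial>distr M (subprob_algebra N) K)"
    unfolding bind_nonempty''[OF K' not_empty]
  proof (rule integral_join[OF f B])
    show "AE M' in distr M (subprob_algebra N) K. emeasure M' (space M') \<le> ennreal 1"
      by (rule AE_I2) (auto simp: space_subprob_algebra dest: subprob_space.emeasure_space_le_1)
  qed (simp_all add: D.finite_measure_axioms)
  also have "\<dots> = (\<integral>x. (\<integral>y. f y \<partial>K x) \<partial>M)"
    using K' integral_measurable_subprob_algebra[OF f] by (rule integral_distr)
  finally show ?thesis .
qed

text \<open>
  Unlike the equivalence for measurable predicates, this direction holds for arbitrary \<open>P\<close>; it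
  will be applied to the equality of a universally measurable function and a representative.
\<close>

lemma AE_bindD:
  assumes K: "K \<in> M \<rightarrow>\<^sub>M prob_algebra N" and M: "space M \<noteq> {}" and P: "AE y in M \<bind> K. P y"
  shows "AE x in M. AE y in K x. P y"
proof -
  have K': "K \<in> M \<rightarrow>\<^sub>M subprob_algebra N"
    using K by (rule measurable_prob_algebraD)
  have sets_bind: "sets (M \<bind> K) = sets N"
    using K' M by (intro Giry_Monad.sets_bind sets_kernel)
  obtain Z where Z: "{y \<in> space (M \<bind> K). \<not> P y} \<subseteq> Z" "Z \<in> null_sets (M \<bind> K)"
    using P by (auto elim: AE_E simp: null_sets_def)
  have Z_sets [measurable]: "Z \<in> sets N"
    using Z(2) sets_bind by auto
  have "AE y in M \<bind> K. y \<notin> Z"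
    using Z(2) by (rule AE_not_in)
  then have "AE x in M. AE y in K x. y \<notin> Z"
    by (subst (asm) AE_bind[OF K']) auto
  with AE_space show ?thesis
  proof eventually_elim
    case (elim x)
    have "space (K x) = space (M \<bind> K)"
      using sets_kernel[OF K' elim(1)] sets_bind by (intro sets_eq_imp_space_eq) simp
    then have "AE y in K x. y \<in> space (M \<bind> K)"
      using AE_space[of "K x"] by simp
    with elim(2) show ?case
      by eventually_elim (use Z(1) in auto)
  qed
qed

lemma integral_bind_bounded_complex:
  fixes f :: "'b \<Rightarrow> complex"
  assumes M: "prob_space M" and K: "K \<in> M \<rightarrow>\<^sub>M prob_algebra N"
    and f: "f \<in> borel_measurable N" and B: "\<And>y. y \<in> space N \<Longrightarrow> norm (f y) \<le> B"
  shows "(\<integral>y. f y \<partial>(M \<bind> K)) = (\<integral>x. (\<integral>y. f y \<partial>K x) \<partial>M)"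
proof -
  interpret prob_space M by fact
  have K': "K \<in> M \<rightarrow>\<^sub>M subprob_algebra N"
    using K by (rule measurable_prob_algebraD)
  interpret MK: prob_space "M \<bind> K"
    using K M by (intro prob_space_bind'[of M M]) (auto simp: space_prob_algebra)
  have sets_MK: "sets (M \<bind> K) = sets N"
    using K' not_empty by (rule sets_bind_measurable)
  have Kx: "prob_space (K x)" "sets (K x) = sets N" if "x \<in> space M" for x
    using measurable_space[OF K that] by (auto simp: space_prob_algebra)
  have int_MK: "integrable (M \<bind> K) f"
    using f B sets_eq_imp_space_eq[OF sets_MK]
    by (intro MK.integrable_const_bound[of _ B]) (auto simp: measurable_cong_sets[OF sets_MK refl])
  have int_K: "integrable (K x) f" if "x \<in> space M" for x
  proof -
    interpret Kx: prob_space "K x" using that by (rule Kx)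
    show ?thesis
      using f B sets_eq_imp_space_eq[OF Kx(2)[OF that]]
      by (intro Kx.integrable_const_bound[of _ B]) (auto simp: measurable_cong_sets[OF Kx(2)[OF that] refl])
  qed
  have int_M: "integrable M (\<lambda>x. \<integral>y. f y \<partial>K x)"
  proof (intro integrable_const_bound[of _ B] AE_I2)
    fix x assume x: "x \<in> space M"
    interpret Kx: prob_space "K x" using x by (rule Kx)
    have "norm (\<integral>y. f y \<partial>K x) \<le> (\<integral>y. norm (f y) \<partial>K x)"
      by (rule integral_norm_bound)
    also have "\<dots> \<le> B"
      using int_K[OF x] B sets_eq_imp_space_eq[OF Kx(2)[OF x]]
      by (intro Kx.integral_le_const) auto
    finally show "norm (\<integral>y. f y \<partial>K x) \<le> B" .
  qed (rule measurable_compose[OF K' integral_measurable_subprob_algebra[OF f]])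
  have "Re (\<integral>y. f y \<partial>(M \<bind> K)) = (\<integral>x. (\<integral>y. Re (f y) \<partial>K x) \<partial>M)"
    using integral_bind_bounded[OF M K, of "\<lambda>y. Re (f y)" B] f B int_MK
    by (auto intro: order_trans[OF abs_Re_le_cmod])
  moreover have "Im (\<integral>y. f y \<partial>(M \<bind> K)) = (\<integral>x. (\<integral>y. Im (f y) \<partial>K x) \<partial>M)"
    using integral_bind_bounded[OF M K, of "\<lambda>y. Im (f y)" B] f B int_MK
    by (auto intro: order_trans[OF abs_Im_le_cmod])
  moreover have "(\<integral>x. (\<integral>y. Re (f y) \<partial>K x) \<partial>M) = (\<integral>x. Re (\<integral>y. f y \<partial>K x) \<partial>M)"
    "(\<integral>x. (\<integral>y. Im (f y) \<partial>K x) \<partial>M) = (\<integral>x. Im (\<integral>y. f y \<partial>K x) \<partial>M)"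
    using int_K by (auto intro!: Bochner_Integration.integral_cong)
  ultimately show ?thesis
    using int_M by (intro complex_eqI) simp_all
qed

section \<open>The pointwise ergodic theorem for a stationary Markov kernel\<close>

text \<open>
  In the following, \<open>T\<close> is the Markov operator of a kernel with stationary probability measure
  \<open>M\<close>, acting on bounded measurable functions. Identities hold pointwise on the space of \<open>M\<close>,
  where the kernel consists of probability measures.
\<close>

locale stationary_kernel = prob_space M for M :: "'a measure" +
  fixes K :: "'a \<Rightarrow> 'a measure"
  assumes kernel: "K \<in> M \<rightarrow>\<^sub>M prob_algebra M"
    and stationary: "M \<bind> K = M"
begin

definition bdd_fun :: "('a \<Rightarrow> real) \<Rightarrow> bool" where
  "bdd_fun f \<longleftrightarrow> f \<in> borel_measurable M \<and> (\<exists>B. \<forall>x\<in>space M. \<bar>f x\<bar> \<le> B)"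

definition T :: "('a \<Rightarrow> real) \<Rightarrow> 'a \<Rightarrow> real" where
  "T f x = (\<integral>y. f y \<partial>K x)"

lemma bdd_funI: "f \<in> borel_measurable M \<Longrightarrow> (\<And>x. x \<in> space M \<Longrightarrow> \<bar>f x\<bar> \<le> B) \<Longrightarrow> bdd_fun f"
  unfolding bdd_fun_def by blast

lemma bdd_fun_bound:
  assumes "bdd_fun f"
  obtains B where "0 \<le> B" "\<And>x. x \<in> space M \<Longrightarrow> \<bar>f x\<bar> \<le> B"
proof -
  obtain B where "\<And>x. x \<in> space M \<Longrightarrow> \<bar>f x\<bar> \<le> B"
    using assms unfolding bdd_fun_def by blast
  then show ?thesis
    using that[of "max 0 B"] by (simp add: le_max_iff_disj)
qed

lemma bdd_fun_measurable [measurable_dest]: "bdd_fun f \<Longrightarrow> f \<in> borel_measurable M"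
  unfolding bdd_fun_def by blast

lemma bdd_fun_const [intro, simp]: "bdd_fun (\<lambda>_. c)"
  by (rule bdd_funI[of _ "\<bar>c\<bar>"]) auto

lemma bdd_fun_add [intro]:
  assumes "bdd_fun f" "bdd_fun g" shows "bdd_fun (\<lambda>x. f x + g x)"
proof -
  obtain A B where "\<And>x. x \<in> space M \<Longrightarrow> \<bar>f x\<bar> \<le> A" "\<And>x. x \<in> space M \<Longrightarrow> \<bar>g x\<bar> \<le> B"
    using assms by (metis bdd_fun_bound)
  then show ?thesis
    using assms by (intro bdd_funI[of _ "A + B"]) (auto simp: bdd_fun_def intro: order_trans[OF abs_triangle_ineq] add_mono)
qed

lemma bdd_fun_mult [intro]:
  assumes "bdd_fun f" "bdd_fun g" shows "bdd_fun (\<lambda>x. f x * g x)"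
proof -
  obtain A B where "0 \<le> A" "\<And>x. x \<in> space M \<Longrightarrow> \<bar>f x\<bar> \<le> A" "\<And>x. x \<in> space M \<Longrightarrow> \<bar>g x\<bar> \<le> B"
    using assms by (metis bdd_fun_bound)
  then show ?thesis
    using assms by (intro bdd_funI[of _ "A * B"]) (auto simp: bdd_fun_def abs_mult intro: mult_mono)
qed

lemma bdd_fun_uminus [intro]: "bdd_fun f \<Longrightarrow> bdd_fun (\<lambda>x. - f x)"
  using bdd_fun_mult[of "\<lambda>_. -1" f] by simp

lemma bdd_fun_diff [intro]: "bdd_fun f \<Longrightarrow> bdd_fun g \<Longrightarrow> bdd_fun (\<lambda>x. f x - g x)"
  using bdd_fun_add[of f "\<lambda>x. - g x"] bdd_fun_uminus[of g] by simp

lemma bdd_fun_sum [intro]: "(\<And>i. i \<in> I \<Longrightarrow> bdd_fun (f i)) \<Longrightarrow> bdd_fun (\<lambda>x. \<Sum>i\<in>I. f i x)"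
  by (induction I rule: infinite_finite_induct) auto

lemma bdd_fun_indicator [intro]: "A \<in> sets M \<Longrightarrow> bdd_fun (indicator A)"
  by (rule bdd_funI[of _ 1]) (auto simp: indicator_def)

lemma bdd_fun_integrable [intro]: "bdd_fun f \<Longrightarrow> integrable M f"
  by (metis bdd_fun_bound bdd_fun_measurable integrable_const_bound AE_I2 real_norm_def)

lemma prob_space_kernel: "x \<in> space M \<Longrightarrow> prob_space (K x)"
  using measurable_space[OF kernel] by (simp add: space_prob_algebra)

lemma sets_kernel [simp]: "x \<in> space M \<Longrightarrow> sets (K x) = sets M"
  using measurable_space[OF kernel] by (simp add: space_prob_algebra)

lemma space_kernel [simp]: "x \<in> space M \<Longrightarrow> space (K x) = space M"
  by (metis sets_kernel sets_eq_imp_space_eq)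

lemma bdd_fun_integrable_kernel:
  assumes "bdd_fun f" "x \<in> space M" shows "integrable (K x) f"
proof -
  interpret K: prob_space "K x" using assms by (intro prob_space_kernel)
  obtain B where "\<And>y. y \<in> space M \<Longrightarrow> \<bar>f y\<bar> \<le> B" using assms by (metis bdd_fun_bound)
  then show ?thesis
    using assms by (intro K.integrable_const_bound[of _ B]) (auto simp: bdd_fun_def cong: measurable_cong_sets)
qed

lemma T_mono:
  assumes "bdd_fun f" "bdd_fun g" "\<And>y. y \<in> space M \<Longrightarrow> f y \<le> g y" "x \<in> space M"
  shows "T f x \<le> T g x"
  unfolding T_def using assms by (intro integral_mono bdd_fun_integrable_kernel) auto

lemma T_const [simp]: "x \<in> space M \<Longrightarrow> T (\<lambda>_. c) x = c"
  using prob_space.prob_space[OF prob_space_kernel, of x] by (simp add: T_def)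

lemma T_add: "bdd_fun f \<Longrightarrow> bdd_fun g \<Longrightarrow> x \<in> space M \<Longrightarrow> T (\<lambda>x. f x + g x) x = T f x + T g x"
  unfolding T_def by (intro Bochner_Integration.integral_add bdd_fun_integrable_kernel)

lemma T_diff: "bdd_fun f \<Longrightarrow> bdd_fun g \<Longrightarrow> x \<in> space M \<Longrightarrow> T (\<lambda>x. f x - g x) x = T f x - T g x"
  unfolding T_def by (intro Bochner_Integration.integral_diff bdd_fun_integrable_kernel)

lemma T_cmult: "T (\<lambda>x. c * f x) x = c * T f x"
  unfolding T_def by simp

lemma T_uminus: "T (\<lambda>x. - f x) x = - T f x"
  unfolding T_def by simp

lemma T_sum:
  "(\<And>i. i \<in> I \<Longrightarrow> bdd_fun (f i)) \<Longrightarrow> x \<in> space M \<Longrightarrow> T (\<lambda>x. \<Sum>i\<in>I. f i x) x = (\<Sum>i\<in>I. T (f i) x)"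
  unfolding T_def by (intro Bochner_Integration.integral_sum bdd_fun_integrable_kernel)

lemma T_abs_le:
  assumes "bdd_fun f" "\<And>y. y \<in> space M \<Longrightarrow> \<bar>f y\<bar> \<le> B" "x \<in> space M"
  shows "\<bar>T f x\<bar> \<le> B"
proof -
  have "T f x \<le> T (\<lambda>_. B) x" "T (\<lambda>_. - B) x \<le> T f x"
    using assms by (intro T_mono bdd_fun_const; force simp: abs_le_iff)+
  then show ?thesis using assms(3) by (simp add: abs_le_iff)
qed

lemma bdd_fun_T [intro]:
  assumes "bdd_fun f" shows "bdd_fun (T f)"
proof -
  obtain B where B: "\<And>x. x \<in> space M \<Longrightarrow> \<bar>f x\<bar> \<le> B"
    using assms by (metis bdd_fun_bound)
  have "T f \<in> borel_measurable M"
    unfolding T_def [abs_def]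
    using measurable_compose[OF measurable_prob_algebraD[OF kernel]
        integral_measurable_subprob_algebra[OF bdd_fun_measurable[OF assms]]] by simp
  then show ?thesis
    using T_abs_le[OF assms B] by (intro bdd_funI[of _ B])
qed

lemma integral_T: "bdd_fun f \<Longrightarrow> (\<integral>x. T f x \<partial>M) = (\<integral>x. f x \<partial>M)"
  using integral_bind_bounded[OF prob_space_axioms kernel, of f] unfolding T_def stationary
  by (metis bdd_fun_bound bdd_fun_measurable)

lemma AE_kernel: "AE x in M. P x \<Longrightarrow> AE x in M. AE y in K x. P y"
  using AE_bindD[OF kernel not_empty, of P] unfolding stationary .

lemma T_LIMSEQ:
  assumes u: "\<And>n. bdd_fun (u n)" and v: "bdd_fun v"
    and B: "\<And>n y. y \<in> space M \<Longrightarrow> \<bar>u n y\<bar> \<le> B"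
    and lim: "\<And>y. y \<in> space M \<Longrightarrow> (\<lambda>n. u n y) \<longlonglongrightarrow> v y" and x: "x \<in> space M"
  shows "(\<lambda>n. T (u n) x) \<longlonglongrightarrow> T v x"
proof -
  interpret K: prob_space "K x" using x by (rule prob_space_kernel)
  show ?thesis
    unfolding T_def
    by (rule integral_dominated_convergence[where w = "\<lambda>_. B"])
      (use assms in \<open>auto simp: bdd_fun_def cong: measurable_cong_sets intro!: AE_I2\<close>)
qed

definition S :: "nat \<Rightarrow> ('a \<Rightarrow> real) \<Rightarrow> 'a \<Rightarrow> real" where
  "S n f x = (\<Sum>j<n. (T ^^ j) f x)"

definition avg :: "nat \<Rightarrow> ('a \<Rightarrow> real) \<Rightarrow> 'a \<Rightarrow> real" where
  "avg n f x = S n f x / real n"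

lemma bdd_fun_T_pow [intro]: "bdd_fun f \<Longrightarrow> bdd_fun ((T ^^ j) f)"
  by (induction j) auto

lemma T_pow_abs_le:
  assumes "bdd_fun f" "\<And>y. y \<in> space M \<Longrightarrow> \<bar>f y\<bar> \<le> B" "x \<in> space M"
  shows "\<bar>(T ^^ j) f x\<bar> \<le> B"
  using assms(3)
proof (induction j arbitrary: x)
  case (Suc j)
  then show ?case using assms(1) by (auto intro: T_abs_le)
qed (use assms in auto)

lemma T_cong: "(\<And>y. y \<in> space M \<Longrightarrow> f y = g y) \<Longrightarrow> x \<in> space M \<Longrightarrow> T f x = T g x"
  unfolding T_def by (intro Bochner_Integration.integral_cong) auto

lemma T_cong_AE:
  assumes "bdd_fun f" "bdd_fun g" "AE y in K x. f y = g y" "x \<in> space M"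
  shows "T f x = T g x"
  unfolding T_def using assms
  by (intro integral_cong_AE borel_measurable_integrable bdd_fun_integrable_kernel)

lemma T_pow_uminus: "(T ^^ j) (\<lambda>x. - f x) = (\<lambda>x. - (T ^^ j) f x)"
  by (induction j) (auto simp: T_uminus)

lemma T_pow_diff:
  assumes "bdd_fun f" "bdd_fun g" "x \<in> space M"
  shows "(T ^^ j) (\<lambda>x. f x - g x) x = (T ^^ j) f x - (T ^^ j) g x"
  using assms(3)
proof (induction j arbitrary: x)
  case (Suc j)
  have "(T ^^ Suc j) (\<lambda>x. f x - g x) x = T (\<lambda>x. (T ^^ j) f x - (T ^^ j) g x) x"
    using Suc by (auto intro: T_cong)
  then show ?case using Suc.prems assms(1,2) by (simp add: T_diff bdd_fun_T_pow)
qed simp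

lemma T_pow_const: "x \<in> space M \<Longrightarrow> (T ^^ j) (\<lambda>_. c) x = c"
proof (induction j arbitrary: x)
  case (Suc j)
  have "T ((T ^^ j) (\<lambda>_. c)) x = T (\<lambda>_. c) x"
    using Suc by (intro T_cong)
  then show ?case using Suc.prems by simp
qed simp

lemma bdd_fun_S [intro]: "bdd_fun f \<Longrightarrow> bdd_fun (S n f)"
  unfolding S_def [abs_def] by auto

lemma S_Suc:
  assumes "bdd_fun f" "x \<in> space M"
  shows "S (Suc n) f x = f x + T (S n f) x"
  using assms unfolding S_def [abs_def]
  by (subst sum.lessThan_Suc_shift, subst T_sum) auto

lemma bdd_fun_avg [intro]: "bdd_fun f \<Longrightarrow> bdd_fun (avg n f)"
  using bdd_fun_mult[of "S n f" "\<lambda>_. 1 / real n"] by (auto simp: avg_def [abs_def])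

lemma avg_abs_le:
  assumes "bdd_fun f" "\<And>y. y \<in> space M \<Longrightarrow> \<bar>f y\<bar> \<le> B" "0 \<le> B" "x \<in> space M"
  shows "\<bar>avg n f x\<bar> \<le> B"
proof (cases "n = 0")
  case False
  have "\<bar>S n f x\<bar> \<le> (\<Sum>j<n. \<bar>(T ^^ j) f x\<bar>)"
    unfolding S_def by (rule sum_abs)
  also have "\<dots> \<le> (\<Sum>j<n. B)"
    using assms by (intro sum_mono T_pow_abs_le) auto
  finally show ?thesis
    using False by (simp add: avg_def field_simps)
qed (use assms in \<open>simp add: avg_def\<close>)

lemma avg_uminus: "avg n (\<lambda>x. - f x) x = - avg n f x"
  by (simp add: avg_def S_def T_pow_uminus sum_negf)

lemma T_avg:
  assumes "bdd_fun f" "x \<in> space M"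
  shows "T (avg n f) x = avg n f x + ((T ^^ n) f x - f x) / real n"
proof -
  have "T (avg n f) x = T (S n f) x / real n"
    using T_cmult[of "1 / real n" "S n f" x] by (simp add: avg_def [abs_def])
  also have "T (S n f) x = S n f x + ((T ^^ n) f x - f x)"
    using S_Suc[OF assms, of n] by (simp add: S_def)
  finally show ?thesis
    by (simp add: avg_def [abs_def] add_divide_distrib)
qed

text \<open>
  The running maximum of \<open>0\<close> and the first \<open>n\<close> ergodic sums of \<open>g\<close> satisfies \<open>F \<le> g + T F\<close> where it
  is positive. This recursion produces a majorant of that maximum with the same property, and
  it is monotone in \<open>n\<close>.
\<close>

definition hopf :: "('a \<Rightarrow> real) \<Rightarrow> nat \<Rightarrow> 'a \<Rightarrow> real" where
  "hopf g n = ((\<lambda>F x. max 0 (g x + T F x)) ^^ n) (\<lambda>_. 0)"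

lemma hopf_0: "hopf g 0 x = 0" and hopf_Suc: "hopf g (Suc n) x = max 0 (g x + T (hopf g n) x)"
  by (auto simp: hopf_def)

lemma bdd_fun_max:
  assumes "bdd_fun f" shows "bdd_fun (\<lambda>x. max 0 (f x))"
proof -
  obtain B where "\<And>x. x \<in> space M \<Longrightarrow> \<bar>f x\<bar> \<le> B"
    using assms by (metis bdd_fun_bound)
  then show ?thesis
    using bdd_fun_measurable[OF assms] by (intro bdd_funI[of _ B]) (force simp: max_def)+
qed

lemma bdd_fun_hopf: "bdd_fun g \<Longrightarrow> bdd_fun (hopf g n)"
proof (induction n)
  case (Suc n)
  then have "bdd_fun (\<lambda>x. max 0 (g x + T (hopf g n) x))"
    by (intro bdd_fun_max bdd_fun_add bdd_fun_T)
  then show ?case by (simp add: hopf_Suc [abs_def])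
qed (simp add: hopf_0 [abs_def])

lemma hopf_nonneg: "0 \<le> hopf g n x"
  by (cases n) (auto simp: hopf_0 hopf_Suc)

lemma hopf_mono:
  assumes "bdd_fun g" "x \<in> space M" shows "hopf g n x \<le> hopf g (Suc n) x"
  using assms(2)
proof (induction n arbitrary: x)
  case (Suc n)
  then have "T (hopf g n) x \<le> T (hopf g (Suc n)) x"
    using assms(1) by (intro T_mono bdd_fun_hopf)
  then show ?case by (auto simp: hopf_Suc[of g n] hopf_Suc[of g "Suc n"])
qed (simp add: hopf_0 hopf_nonneg)

lemma S_le_hopf:
  assumes "bdd_fun g" "x \<in> space M" shows "S n g x \<le> hopf g n x"
  using assms(2)
proof (induction n arbitrary: x)
  case (Suc n)
  then have "T (S n g) x \<le> T (hopf g n) x"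
    using assms(1) by (intro T_mono bdd_fun_hopf bdd_fun_S)
  then show ?case using Suc.prems assms(1) by (simp add: hopf_Suc S_Suc)
qed (simp add: hopf_0 S_def)

text \<open>
  Hopf's argument: for \<open>F = hopf g n\<close> we have \<open>g \<ge> F - T F\<close> where \<open>F > 0\<close>, and \<open>g \<ge> - B\<close> on the
  remaining set \<open>Z n\<close>. Integration annihilates \<open>F - T F\<close>, and the measure of \<open>Z n\<close> tends to zero.
\<close>

lemma maximal_ergodic:
  assumes g: "bdd_fun g" and pos: "AE x in M. \<exists>n. 0 < S n g x"
  shows "0 \<le> (\<integral>x. g x \<partial>M)"
proof -
  obtain B where B: "0 \<le> B" "\<And>x. x \<in> space M \<Longrightarrow> \<bar>g x\<bar> \<le> B"
    using g by (rule bdd_fun_bound) blast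
  define Z where "Z n = {x \<in> space M. hopf g n x \<le> 0}" for n
  have Z [measurable]: "Z n \<in> sets M" for n
    using bdd_fun_measurable[OF bdd_fun_hopf[OF g]] unfolding Z_def by measurable
  have bound: "- B * (\<integral>x. indicator (Z n) x \<partial>M) \<le> (\<integral>x. g x \<partial>M)" for n
  proof -
    let ?F = "hopf g n"
    have F: "bdd_fun ?F" using g by (rule bdd_fun_hopf)
    have "?F x - T ?F x - B * indicator (Z n) x \<le> g x" if x: "x \<in> space M" for x
    proof (cases "?F x \<le> 0")
      case True
      have "0 \<le> T ?F x"
        using T_mono[OF bdd_fun_const F, of 0 x] hopf_nonneg x by simp
      then show ?thesis using True B(2)[OF x] x by (simp add: Z_def abs_le_iff)
    next
      case False
      then obtain m where m: "n = Suc m" by (cases n) (auto simp: hopf_0)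
      have "T (hopf g m) x \<le> T ?F x"
        unfolding m using g x by (intro T_mono bdd_fun_hopf hopf_mono)
      then show ?thesis using False by (auto simp: m hopf_Suc Z_def max_def split: if_splits)
    qed
    then have "(\<integral>x. ?F x - T ?F x - B * indicator (Z n) x \<partial>M) \<le> (\<integral>x. g x \<partial>M)"
      using F g Z by (intro integral_mono bdd_fun_integrable bdd_fun_diff bdd_fun_mult) auto
    also have "(\<integral>x. ?F x - T ?F x - B * indicator (Z n) x \<partial>M)
        = (\<integral>x. ?F x \<partial>M) - (\<integral>x. T ?F x \<partial>M) - B * (\<integral>x. indicator (Z n) x \<partial>M)"
      using bdd_fun_integrable[OF F] bdd_fun_integrable[OF bdd_fun_T[OF F]]
        bdd_fun_integrable[OF bdd_fun_indicator[OF Z]]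
      by simp
    finally show ?thesis using integral_T[OF F] by simp
  qed
  have "(\<lambda>n. \<integral>x. indicator (Z n) x \<partial>M) \<longlonglongrightarrow> (\<integral>x. (0::real) \<partial>M)"
  proof (rule integral_dominated_convergence[where w = "\<lambda>_. 1"])
    show "AE x in M. (\<lambda>n. indicator (Z n) x :: real) \<longlonglongrightarrow> 0"
      using pos AE_space
    proof eventually_elim
      case (elim x)
      then obtain n where "0 < S n g x" by blast
      then have n: "0 < hopf g n x"
        using S_le_hopf[OF g, of x n] elim by linarith
      have "0 < hopf g m x" if "n \<le> m" for m
        using that n hopf_mono[OF g, of x] elim
        by (induction rule: dec_induct) (auto intro: less_le_trans)
      then have "eventually (\<lambda>m. indicator (Z m) x = (0::real)) sequentially"
        unfolding eventually_sequentially by (force simp: Z_def indicator_def)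
      then show ?case by (rule tendsto_eventually)
    qed
  qed (auto simp: indicator_def)
  then have "(\<lambda>n. - B * (\<integral>x. indicator (Z n) x \<partial>M)) \<longlonglongrightarrow> - B * 0"
    by (intro tendsto_mult tendsto_const) simp
  then have "- B * 0 \<le> (\<integral>x. g x \<partial>M)"
    using bound by (intro LIMSEQ_le_const2) auto
  then show ?thesis by simp
qed

definition tail_sup :: "('a \<Rightarrow> real) \<Rightarrow> nat \<Rightarrow> 'a \<Rightarrow> real" where
  "tail_sup f m x = (SUP n\<in>{m..}. avg n f x)"

text \<open>
  The limes superior of the averages as the real-valued limit of the decreasing sequence
  \<open>tail_sup f\<close>, which keeps the operator \<open>T\<close> on real functions.
\<close>

definition upper_limit :: "('a \<Rightarrow> real) \<Rightarrow> 'a \<Rightarrow> real" where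
  "upper_limit f x = (INF m. tail_sup f m x)"

lemma bdd_above_avg:
  assumes "bdd_fun f" "x \<in> space M" shows "bdd_above ((\<lambda>n. avg n f x) ` I)"
proof -
  obtain B where B: "0 \<le> B" "\<And>x. x \<in> space M \<Longrightarrow> \<bar>f x\<bar> \<le> B"
    using assms(1) by (rule bdd_fun_bound) blast
  then have "avg n f x \<le> B" for n
    using avg_abs_le[OF assms(1) B(2) B(1) assms(2)] by (simp add: abs_le_iff)
  then show ?thesis by (intro bdd_aboveI2)
qed

lemma avg_le_tail_sup: "bdd_fun f \<Longrightarrow> x \<in> space M \<Longrightarrow> m \<le> n \<Longrightarrow> avg n f x \<le> tail_sup f m x"
  unfolding tail_sup_def by (intro cSUP_upper bdd_above_avg) auto

lemma tail_sup_abs_le: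
  assumes "bdd_fun f" "\<And>y. y \<in> space M \<Longrightarrow> \<bar>f y\<bar> \<le> B" "0 \<le> B" "x \<in> space M"
  shows "\<bar>tail_sup f m x\<bar> \<le> B"
proof -
  have A: "avg n f x \<le> B" "- B \<le> avg n f x" for n
    using avg_abs_le[OF assms] by (simp_all add: abs_le_iff minus_le_iff)
  have "tail_sup f m x \<le> B"
    unfolding tail_sup_def using A by (intro cSUP_least) auto
  moreover have "- B \<le> tail_sup f m x"
    using A(2)[of m] avg_le_tail_sup[OF assms(1,4), of m m] by simp
  ultimately show ?thesis by (simp add: abs_le_iff)
qed

lemma bdd_fun_tail_sup [intro]:
  assumes "bdd_fun f" shows "bdd_fun (tail_sup f m)"
proof -
  obtain B where B: "0 \<le> B" "\<And>x. x \<in> space M \<Longrightarrow> \<bar>f x\<bar> \<le> B"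
    using assms(1) by (rule bdd_fun_bound) blast
  have "tail_sup f m \<in> borel_measurable M"
    unfolding tail_sup_def [abs_def]
    using assms by (intro borel_measurable_cSUP bdd_above_avg bdd_fun_measurable bdd_fun_avg) auto
  then show ?thesis
    using tail_sup_abs_le[OF assms B(2,1)] by (intro bdd_funI[of _ B])
qed

lemma tail_sup_LIMSEQ:
  assumes f: "bdd_fun f" and x: "x \<in> space M"
  shows "(\<lambda>m. tail_sup f m x) \<longlonglongrightarrow> upper_limit f x"
    and "upper_limit f x \<le> tail_sup f m x"
proof -
  obtain B where B: "0 \<le> B" "\<And>x. x \<in> space M \<Longrightarrow> \<bar>f x\<bar> \<le> B"
    using f by (rule bdd_fun_bound) blast
  have bb: "bdd_below (range (\<lambda>m. tail_sup f m x))"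
    using tail_sup_abs_le[OF f B(2,1) x] by (intro bdd_belowI2[of _ "- B"]) (auto simp: abs_le_iff minus_le_iff)
  have "decseq (\<lambda>m. tail_sup f m x)"
    unfolding decseq_def tail_sup_def
    using f x by (intro allI impI cSUP_subset_mono bdd_above_avg) auto
  then show "(\<lambda>m. tail_sup f m x) \<longlonglongrightarrow> upper_limit f x"
    unfolding upper_limit_def using bb by (intro LIMSEQ_decseq_INF)
  show "upper_limit f x \<le> tail_sup f m x"
    unfolding upper_limit_def using bb by (intro cINF_lower) auto
qed

lemma bdd_fun_upper_limit [intro]:
  assumes "bdd_fun f" shows "bdd_fun (upper_limit f)"
proof -
  obtain B where B: "0 \<le> B" "\<And>x. x \<in> space M \<Longrightarrow> \<bar>f x\<bar> \<le> B"
    using assms(1) by (rule bdd_fun_bound) blast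
  have "upper_limit f \<in> borel_measurable M"
    using tail_sup_LIMSEQ(1)[OF assms] bdd_fun_measurable[OF bdd_fun_tail_sup[OF assms]]
    by (rule borel_measurable_LIMSEQ_real)
  moreover have "\<bar>upper_limit f x\<bar> \<le> B" if "x \<in> space M" for x
    using tendsto_rabs[OF tail_sup_LIMSEQ(1)[OF assms that]] tail_sup_abs_le[OF assms B(2,1) that]
    by (intro LIMSEQ_le_const2) auto
  ultimately show ?thesis by (intro bdd_funI[of _ B])
qed

text \<open>
  Since \<open>T (avg n f)\<close> and \<open>avg n f\<close> differ by at most \<open>2 B / n\<close>, the upper limit of the averages is
  bounded by \<open>T (tail_sup f m)\<close> for every \<open>m\<close>; let \<open>m\<close> tend to infinity.
\<close>

lemma upper_limit_le_T:
  assumes f: "bdd_fun f" and x: "x \<in> space M"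
  shows "upper_limit f x \<le> T (upper_limit f) x"
proof -
  obtain B where B: "0 \<le> B" "\<And>x. x \<in> space M \<Longrightarrow> \<bar>f x\<bar> \<le> B"
    using f by (rule bdd_fun_bound) blast
  have le: "upper_limit f x \<le> T (tail_sup f m) x" for m
  proof -
    have "tail_sup f k x \<le> T (tail_sup f m) x + 2 * B * inverse (real k)" if k: "m \<le> k" "1 \<le> k" for k
      unfolding tail_sup_def[of f k]
    proof (rule cSUP_least)
      fix n assume "n \<in> {k..}"
      then have n: "k \<le> n" by simp
      have "avg n f x = T (avg n f) x + (f x - (T ^^ n) f x) / real n"
        using T_avg[OF f x, of n] by (simp add: diff_divide_distrib)
      also have "T (avg n f) x \<le> T (tail_sup f m) x"
        using f x n k by (intro T_mono avg_le_tail_sup) auto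
      also have "(f x - (T ^^ n) f x) / real n \<le> 2 * B / real n"
        using B(2)[OF x] T_pow_abs_le[OF f B(2) x, of n]
        by (intro divide_right_mono) auto
      also have "2 * B / real n \<le> 2 * B * inverse (real k)"
        using B(1) n k by (simp add: field_simps mult_left_mono)
      finally show "avg n f x \<le> T (tail_sup f m) x + 2 * B * inverse (real k)" by simp
    qed auto
    then have "\<exists>N. \<forall>k\<ge>N. tail_sup f k x \<le> T (tail_sup f m) x + 2 * B * inverse (real k)"
      by (intro exI[of _ "max m 1"]) auto
    moreover have "(\<lambda>k. T (tail_sup f m) x + 2 * B * inverse (real k)) \<longlonglongrightarrow> T (tail_sup f m) x + 2 * B * 0"
      by (intro tendsto_intros tendsto_inverse_0_at_top filterlim_real_sequentially)
    ultimately show ?thesis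
      using LIMSEQ_le[OF tail_sup_LIMSEQ(1)[OF f x]] by simp
  qed
  have "(\<lambda>m. T (tail_sup f m) x) \<longlonglongrightarrow> T (upper_limit f) x"
    using f x tail_sup_LIMSEQ(1)[OF f] tail_sup_abs_le[OF f B(2,1)]
    by (intro T_LIMSEQ[where B = B]) auto
  then show ?thesis using le by (intro LIMSEQ_le_const) auto
qed

text \<open>
  A function dominated by its image under \<open>T\<close> agrees with it almost everywhere, because both have the
  same integral.
\<close>

lemma AE_eq_T_if_le_T:
  assumes h: "bdd_fun h" and le: "\<And>x. x \<in> space M \<Longrightarrow> h x \<le> T h x"
  shows "AE x in M. T h x = h x"
proof -
  have int: "integrable M (\<lambda>x. T h x - h x)"
    using h by auto
  have "(\<integral>x. T h x - h x \<partial>M) = 0"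
    using bdd_fun_integrable[OF h] bdd_fun_integrable[OF bdd_fun_T[OF h]] integral_T[OF h] by simp
  moreover have "AE x in M. 0 \<le> T h x - h x"
    using le by (intro AE_I2) simp
  ultimately have "AE x in M. T h x - h x = 0"
    using integral_nonneg_eq_0_iff_AE[OF int] by simp
  then show ?thesis by eventually_elim simp
qed

lemma AE_T_pow_fixed:
  assumes h: "bdd_fun h" and inv: "AE x in M. T h x = h x"
  shows "AE x in M. (T ^^ j) h x = h x"
proof (induction j)
  case (Suc j)
  from AE_kernel[OF this] inv AE_space show ?case
  proof eventually_elim
    case (elim x)
    have "T ((T ^^ j) h) x = T h x"
      using h elim by (intro T_cong_AE) auto
    then show ?case using elim by simp
  qed
qed simp

text \<open>
  By invariance of the upper limit \<open>h\<close>, the \<open>n\<close>-th ergodic sum of \<open>f - h + e\<close> is almost everywhere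
  \<open>n (avg n f - h + e)\<close>, which is positive for some \<open>n\<close> by the definition of \<open>h\<close>. The maximal
  ergodic lemma applies on the whole space.
\<close>

lemma integral_upper_limit_le:
  assumes f: "bdd_fun f"
  shows "(\<integral>x. upper_limit f x \<partial>M) \<le> (\<integral>x. f x \<partial>M)"
proof (rule field_le_epsilon)
  fix e :: real assume e: "0 < e"
  let ?h = "upper_limit f"
  have h: "bdd_fun ?h" using f ..
  let ?g = "\<lambda>x. f x - (?h x - e)"
  have g: "bdd_fun ?g" using f h by (intro bdd_fun_diff bdd_fun_const)
  have "AE x in M. \<forall>j. (T ^^ j) ?h x = ?h x"
    unfolding AE_all_countable
    by (intro allI AE_T_pow_fixed AE_eq_T_if_le_T h upper_limit_le_T f)
  then have "AE x in M. \<exists>n. 0 < S n ?g x"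
    using AE_space
  proof eventually_elim
    case (elim x)
    have "?h x - e < tail_sup f 1 x"
      using tail_sup_LIMSEQ(2)[OF f elim(2), of 1] e by simp
    then obtain n where n: "1 \<le> n" "?h x - e < avg n f x"
      unfolding tail_sup_def using bdd_above_avg[OF f elim(2)] by (subst (asm) less_cSUP_iff) auto
    have "(T ^^ j) ?g x = (T ^^ j) f x - (?h x - e)" for j
      using f h elim by (simp add: T_pow_diff T_pow_const bdd_fun_diff)
    then have "S n ?g x = S n f x - real n * (?h x - e)"
      by (simp add: S_def sum_subtractf)
    also have "\<dots> = real n * (avg n f x - (?h x - e))"
      using n by (simp add: avg_def field_simps)
    finally show ?case using n by (intro exI[of _ n]) simp
  qed
  then have "0 \<le> (\<integral>x. ?g x \<partial>M)" by (rule maximal_ergodic[OF g])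
  also have "\<dots> = (\<integral>x. f x \<partial>M) - (\<integral>x. ?h x \<partial>M) + e"
    using bdd_fun_integrable[OF f] bdd_fun_integrable[OF h] by (simp add: prob_space)
  finally show "(\<integral>x. ?h x \<partial>M) \<le> (\<integral>x. f x \<partial>M) + e" by simp
qed

text \<open>
  The upper limit of \<open>- f\<close> is minus the lower limit of \<open>f\<close>. Both upper limits have integral at most
  that of the function, so their sum, which is nonnegative, has integral at most zero.
\<close>

theorem pointwise_ergodic:
  assumes f: "bdd_fun f"
  shows "AE x in M. T (upper_limit f) x = upper_limit f x"
    and "(\<integral>x. upper_limit f x \<partial>M) = (\<integral>x. f x \<partial>M)"
    and "AE x in M. (\<lambda>n. avg n f x) \<longlonglongrightarrow> upper_limit f x"
proof -
  let ?g = "\<lambda>x. - f x"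
  have g: "bdd_fun ?g" using f by auto
  have h: "bdd_fun (upper_limit f)" "bdd_fun (upper_limit ?g)" using f g by auto
  note int = h[THEN bdd_fun_integrable]
  show "AE x in M. T (upper_limit f) x = upper_limit f x"
    by (intro AE_eq_T_if_le_T h upper_limit_le_T f)
  have lower: "- tail_sup ?g n x \<le> avg n f x" if "x \<in> space M" for n x
    using avg_le_tail_sup[OF g that, of n n] by (simp add: avg_uminus)
  have nn: "0 \<le> upper_limit f x + upper_limit ?g x" if x: "x \<in> space M" for x
  proof (rule LIMSEQ_le_const)
    show "(\<lambda>n. tail_sup f n x + tail_sup ?g n x) \<longlonglongrightarrow> upper_limit f x + upper_limit ?g x"
      using tail_sup_LIMSEQ(1) f g x by (intro tendsto_add)
    have "0 \<le> tail_sup f n x + tail_sup ?g n x" for n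
      using lower[OF x, of n] avg_le_tail_sup[OF f x, of n n] by simp
    then show "\<exists>N. \<forall>n\<ge>N. 0 \<le> tail_sup f n x + tail_sup ?g n x" by blast
  qed
  have le: "(\<integral>x. upper_limit f x \<partial>M) \<le> (\<integral>x. f x \<partial>M)"
    "(\<integral>x. upper_limit ?g x \<partial>M) \<le> - (\<integral>x. f x \<partial>M)"
    using integral_upper_limit_le[OF f] integral_upper_limit_le[OF g] by simp_all
  have "0 \<le> (\<integral>x. upper_limit f x + upper_limit ?g x \<partial>M)"
    using nn by (intro integral_nonneg_AE AE_I2)
  then have ge: "0 \<le> (\<integral>x. upper_limit f x \<partial>M) + (\<integral>x. upper_limit ?g x \<partial>M)"
    using int by simp
  show "(\<integral>x. upper_limit f x \<partial>M) = (\<integral>x. f x \<partial>M)"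
    using le ge by linarith
  have "(\<integral>x. upper_limit f x + upper_limit ?g x \<partial>M) = 0"
    using int le ge by simp
  then have "AE x in M. upper_limit f x + upper_limit ?g x = 0"
    using nn int by (subst (asm) integral_nonneg_eq_0_iff_AE) auto
  then show "AE x in M. (\<lambda>n. avg n f x) \<longlonglongrightarrow> upper_limit f x"
    using AE_space
  proof eventually_elim
    case (elim x)
    show ?case
    proof (rule tendsto_sandwich)
      have "(\<lambda>n. - tail_sup ?g n x) \<longlonglongrightarrow> - upper_limit ?g x"
        using elim g by (intro tendsto_minus tail_sup_LIMSEQ(1))
      also have "- upper_limit ?g x = upper_limit f x"
        using elim by simp
      finally show "(\<lambda>n. - tail_sup ?g n x) \<longlonglongrightarrow> upper_limit f x" .
      show "(\<lambda>n. tail_sup f n x) \<longlonglongrightarrow> upper_limit f x"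
        using elim f by (intro tail_sup_LIMSEQ(1))
    qed (use lower avg_le_tail_sup[OF f] elim in auto)
  qed
qed

text \<open>
  Expanding the square, \<open>?q x = \<integral> (h y - h x)\<^sup>2 K(x, dy)\<close> integrates to zero by invariance and
  stationarity, so a step of the kernel does not change the value of \<open>h\<close>.
\<close>

lemma AE_kernel_constant:
  assumes h: "bdd_fun h" and inv: "AE x in M. T h x = h x"
  shows "AE x in M. AE y in K x. h y = h x"
proof -
  let ?q = "\<lambda>x. T (\<lambda>y. h y * h y) x - 2 * (h x * T h x) + h x * h x"
  have hh: "bdd_fun (\<lambda>y. h y * h y)" using h by auto
  have sq: "?q x = (\<integral>y. (h y - h x) * (h y - h x) \<partial>K x)" if x: "x \<in> space M" for x
  proof -
    have "(\<integral>y. (h y - h x) * (h y - h x) \<partial>K x) = T (\<lambda>y. (h y * h y - 2 * h x * h y) + h x * h x) x"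
      unfolding T_def by (intro Bochner_Integration.integral_cong) (auto simp: algebra_simps)
    also have "\<dots> = ?q x"
      using h x by (simp add: T_add T_diff T_cmult bdd_fun_mult bdd_fun_diff)
    finally show ?thesis by simp
  qed
  have q_nn: "0 \<le> ?q x" if "x \<in> space M" for x
    unfolding sq[OF that] by simp
  have q_bdd: "bdd_fun ?q"
    using h hh by (intro bdd_fun_add bdd_fun_diff bdd_fun_mult bdd_fun_T bdd_fun_const)
  have "(\<integral>x. ?q x \<partial>M) = (\<integral>x. T (\<lambda>y. h y * h y) x - h x * h x \<partial>M)"
    using inv bdd_fun_measurable[OF q_bdd] bdd_fun_measurable[OF bdd_fun_diff[OF bdd_fun_T[OF hh] hh]]
    by (intro integral_cong_AE) (auto elim!: eventually_mono)
  also have "\<dots> = 0"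
    using bdd_fun_integrable[OF hh] bdd_fun_integrable[OF bdd_fun_T[OF hh]] integral_T[OF hh] by simp
  finally have "AE x in M. ?q x = 0"
    using q_nn q_bdd by (subst (asm) integral_nonneg_eq_0_iff_AE) auto
  then show ?thesis
    using AE_space
  proof eventually_elim
    case (elim x)
    have "integrable (K x) (\<lambda>y. (h y - h x) * (h y - h x))"
      using h elim by (intro bdd_fun_integrable_kernel bdd_fun_mult bdd_fun_diff bdd_fun_const)
    then have "AE y in K x. (h y - h x) * (h y - h x) = 0"
      using elim sq[of x] by (subst integral_nonneg_eq_0_iff_AE[symmetric]) auto
    then show ?case by eventually_elim simp
  qed
qed

text \<open>
  It suffices to consider the single set where \<open>h\<close> exceeds its mean: it is invariant since the
  kernel preserves the value of \<open>h\<close>, and it cannot have full measure.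
\<close>

lemma invariant_function_const:
  assumes ergodic: "\<And>A. A \<in> sets M \<Longrightarrow> (AE x in M. T (indicator A) x = indicator A x) \<Longrightarrow> prob A \<in> {0, 1}"
    and h: "bdd_fun h" and inv: "AE x in M. T h x = h x"
  shows "AE x in M. h x = (\<integral>x. h x \<partial>M)"
proof -
  let ?c = "\<integral>x. h x \<partial>M"
  define A where "A = {x \<in> space M. ?c < h x}"
  have A: "A \<in> sets M"
    using bdd_fun_measurable[OF h] unfolding A_def by measurable
  have "AE x in M. T (indicator A) x = indicator A x"
    using AE_kernel_constant[OF h inv] AE_space
  proof eventually_elim
    case (elim x)
    have "AE y in K x. (indicator A y :: real) = indicator A x"
      using elim(1) AE_space[of "K x"] by eventually_elim (use elim(2) in \<open>auto simp: A_def indicator_def\<close>)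
    then have "T (indicator A) x = T (\<lambda>_. indicator A x) x"
      using A elim by (intro T_cong_AE) auto
    then show ?case using elim by simp
  qed
  then consider "prob A = 0" | "prob A = 1"
    using ergodic[OF A] by blast
  then show ?thesis
  proof cases
    case 1
    then have "AE x in M. x \<notin> A"
      using A by (intro AE_not_in null_setsI) (simp_all add: emeasure_eq_measure)
    then have le: "AE x in M. 0 \<le> ?c - h x"
      using AE_space by eventually_elim (auto simp: A_def)
    have int: "integrable M (\<lambda>x. ?c - h x)" using h by auto
    have "(\<integral>x. ?c - h x \<partial>M) = 0"
      using bdd_fun_integrable[OF h] by (simp add: prob_space)
    then have "AE x in M. ?c - h x = 0"
      using integral_nonneg_eq_0_iff_AE[OF int le] by simp
    then show ?thesis by eventually_elim simp
  next
    case 2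
    then have gt: "AE x in M. ?c < h x"
      using AE_in_set_eq_1[OF A] by (auto simp: A_def elim: eventually_mono)
    then have "AE x in M. 0 \<le> h x - ?c"
      by eventually_elim simp
    moreover have int: "integrable M (\<lambda>x. h x - ?c)" using h by auto
    moreover have "(\<integral>x. h x - ?c \<partial>M) = 0"
      using bdd_fun_integrable[OF h] by (simp add: prob_space)
    ultimately have "AE x in M. h x - ?c = 0"
      using integral_nonneg_eq_0_iff_AE[OF int] by simp
    then show ?thesis by eventually_elim simp
  qed
qed

end

section \<open>The Markov kernel of a transfer operator\<close>

lemma prob_measuresD:
  "\<nu> \<in> prob_measures \<Longrightarrow> prob_space \<nu>" "\<nu> \<in> prob_measures \<Longrightarrow> sets \<nu> = sets borel"
  "\<nu> \<in> prob_measures \<Longrightarrow> space \<nu> = UNIV"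
  by (auto simp: prob_measures_def dest: sets_eq_imp_space_eq)

lemma space_prob_algebra_borel: "space (prob_algebra borel) = prob_measures"
  by (auto simp: space_prob_algebra prob_measures_def)

lemma Bcontfun_inverse_compact:
  fixes f :: "'a::topological_space \<Rightarrow> 'b::metric_space"
  assumes "compact (UNIV :: 'a set)" "continuous_on UNIV f"
  shows "apply_bcontfun (Bcontfun f) = f"
  using compact_imp_bounded[OF compact_continuous_image[OF assms(2,1)]] assms(2)
  by (intro Bcontfun_inverse) (auto simp: bcontfun_def)

lemma measurable_apply_bcontfun: "apply_bcontfun \<phi> \<in> borel_measurable borel"
  by (rule borel_measurable_continuous_onI) simp

lemma integrable_apply_bcontfun:
  fixes \<phi> :: "'a::topological_space \<Rightarrow>\<^sub>C complex"
  assumes "\<nu> \<in> prob_measures"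
  shows "integrable \<nu> (apply_bcontfun \<phi>)"
proof -
  interpret prob_space \<nu> using assms by (rule prob_measuresD)
  show ?thesis
    using measurable_apply_bcontfun[of \<phi>] norm_bounded[of \<phi>]
    by (intro integrable_const_bound[of _ "norm \<phi>"])
      (auto simp: measurable_cong_sets[OF prob_measuresD(2)[OF assms] refl])
qed

lemma measure_closed_LIMSEQ:
  assumes \<nu>: "\<nu> \<in> prob_measures" and F: "closed F" "F \<noteq> {}"
  shows "(\<lambda>k. \<integral>x. cutoff F k x \<partial>\<nu>) \<longlonglongrightarrow> measure \<nu> F"
proof -
  interpret prob_space \<nu> using \<nu> by (rule prob_measuresD)
  have sets: "sets \<nu> = sets borel" using \<nu> by (rule prob_measuresD)
  have "(\<lambda>k. \<integral>x. cutoff F k x \<partial>\<nu>) \<longlonglongrightarrow> (\<integral>x. indicator F x \<partial>\<nu>)"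
  proof (rule integral_dominated_convergence[where w = "\<lambda>_. 1"])
    show "indicator F \<in> borel_measurable \<nu>"
      using F(1) by (simp add: measurable_cong_sets[OF sets refl])
    show "cutoff F k \<in> borel_measurable \<nu>" for k
      by (simp add: measurable_cong_sets[OF sets refl] borel_measurable_continuous_onI continuous_cutoff)
    show "AE x in \<nu>. norm (cutoff F k x) \<le> 1" for k
      by (simp add: cutoff_nonneg cutoff_le_1)
  qed (use cutoff_LIMSEQ[OF F] in auto)
  then show ?thesis
    using F(1) sets by simp
qed

lemma prob_measures_eqI:
  fixes \<nu> \<nu>' :: "'a::metric_space measure"
  assumes \<nu>: "\<nu> \<in> prob_measures" "\<nu>' \<in> prob_measures"
    and eq: "\<And>\<phi> :: 'a \<Rightarrow>\<^sub>C complex. (\<integral>x. apply_bcontfun \<phi> x \<partial>\<nu>) = (\<integral>x. apply_bcontfun \<phi> x \<partial>\<nu>')"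
  shows "\<nu> = \<nu>'"
proof (rule measure_eqI_generator_eq[where E = "Collect closed" and \<Omega> = UNIV and A = "\<lambda>_. UNIV"])
  interpret A: prob_space \<nu> using \<nu>(1) by (rule prob_measuresD)
  interpret B: prob_space \<nu>' using \<nu>(2) by (rule prob_measuresD)
  fix F :: "'a set" assume "F \<in> Collect closed"
  then have F: "closed F" by simp
  show "emeasure \<nu> F = emeasure \<nu>' F"
  proof (cases "F = {}")
    case False
    have "(\<integral>x. cutoff F k x \<partial>\<nu>) = (\<integral>x. cutoff F k x \<partial>\<nu>')" for k
    proof -
      have "(\<lambda>x. complex_of_real (cutoff F k x)) \<in> bcontfun"
        by (rule bcontfun_normI[where b = 1])
          (auto intro!: continuous_intros continuous_cutoff simp: cutoff_nonneg cutoff_le_1)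
      then have "complex_of_real (\<integral>x. cutoff F k x \<partial>\<nu>) = complex_of_real (\<integral>x. cutoff F k x \<partial>\<nu>')"
        using eq[of "Bcontfun (\<lambda>x. complex_of_real (cutoff F k x))"] by (simp add: Bcontfun_inverse)
      then show ?thesis by simp
    qed
    then have "measure \<nu> F = measure \<nu>' F"
      using measure_closed_LIMSEQ[OF \<nu>(1) F False] measure_closed_LIMSEQ[OF \<nu>(2) F False]
      by (simp add: LIMSEQ_unique)
    then show ?thesis by (simp add: A.emeasure_eq_measure B.emeasure_eq_measure)
  qed simp
next
  show "emeasure \<nu> UNIV \<noteq> \<infinity>"
    using prob_space.emeasure_space_1[OF prob_measuresD(1)[OF \<nu>(1)]] prob_measuresD(3)[OF \<nu>(1)] by simp
qed (use prob_measuresD(2)[OF \<nu>(1)] prob_measuresD(2)[OF \<nu>(2)] in \<open>auto simp: Int_stable_def borel_eq_closed\<close>)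

locale compact_transfer_operator =
  fixes L :: "('a::metric_space \<Rightarrow>\<^sub>C complex) \<Rightarrow> ('a \<Rightarrow>\<^sub>C complex)"
  assumes compact_space: "compact (UNIV :: 'a set)"
    and transfer: "transfer_operator L"
begin

text \<open>
  Taking the real part loses nothing, as \<open>L\<close> maps real functions to real functions
  (\<open>Im_L_real\<close>), and it makes the Riesz theorem for real functionals applicable.
\<close>

definition real_section :: "'a \<Rightarrow> ('a \<Rightarrow> real) \<Rightarrow> real" where
  "real_section x f = Re (apply_bcontfun (L (Bcontfun (\<lambda>y. complex_of_real (f y)))) x)"

lemma L_add: "L (\<phi> + \<psi>) = L \<phi> + L \<psi>"
  and L_scale: "L (cscale_bcontfun c \<phi>) = cscale_bcontfun c (L \<phi>)"
  and L_nonneg: "(\<And>x. apply_bcontfun \<phi> x \<in> \<real>\<^sub>\<ge>\<^sub>0) \<Longrightarrow> apply_bcontfun (L \<phi>) x \<in> \<real>\<^sub>\<ge>\<^sub>0"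
  and L_one: "L (const_bcontfun 1) = const_bcontfun 1"
  using transfer by (auto simp: transfer_operator_def)

lemma apply_Bcontfun_real:
  "continuous_on UNIV (f :: 'a \<Rightarrow> real) \<Longrightarrow>
    apply_bcontfun (Bcontfun (\<lambda>y. complex_of_real (f y))) y = complex_of_real (f y)"
  using Bcontfun_inverse_compact[OF compact_space, of "\<lambda>y. complex_of_real (f y)"]
  by (auto intro: continuous_intros)

lemma apply_const_bcontfun: "apply_bcontfun (const_bcontfun c) x = c"
  by (rule const_bcontfun.rep_eq [THEN fun_cong])

lemma normalised_positive_functional_section: "normalised_positive_functional (real_section x)"
proof
  fix f g :: "'a \<Rightarrow> real" assume f: "continuous_on UNIV f" and g: "continuous_on UNIV g"
  have "Bcontfun (\<lambda>y. complex_of_real (f y + g y))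
      = Bcontfun (\<lambda>y. complex_of_real (f y)) + Bcontfun (\<lambda>y. complex_of_real (g y))"
    using f g by (intro bcontfun_eqI) (simp add: apply_Bcontfun_real continuous_on_add del: of_real_add, simp)
  then show "real_section x (\<lambda>x. f x + g x) = real_section x f + real_section x g"
    by (simp add: real_section_def L_add)
next
  fix f :: "'a \<Rightarrow> real" and c assume f: "continuous_on UNIV f"
  have "Bcontfun (\<lambda>y. complex_of_real (c * f y))
      = cscale_bcontfun (complex_of_real c) (Bcontfun (\<lambda>y. complex_of_real (f y)))"
    using f by (intro bcontfun_eqI) (simp add: apply_Bcontfun_real continuous_on_mult_left del: of_real_mult, simp)
  then show "real_section x (\<lambda>x. c * f x) = c * real_section x f"
    by (simp add: real_section_def L_scale)
next
  fix f :: "'a \<Rightarrow> real" assume f: "continuous_on UNIV f" "\<And>x. 0 \<le> f x"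
  then have "apply_bcontfun (L (Bcontfun (\<lambda>y. complex_of_real (f y)))) x \<in> \<real>\<^sub>\<ge>\<^sub>0"
    by (intro L_nonneg) (simp add: apply_Bcontfun_real)
  then show "0 \<le> real_section x f"
    by (auto simp: real_section_def nonneg_Reals_def)
next
  have "Bcontfun (\<lambda>y. complex_of_real 1) = (const_bcontfun 1 :: 'a \<Rightarrow>\<^sub>C complex)"
    by (intro bcontfun_eqI) (use apply_Bcontfun_real[of "\<lambda>_. 1"] in \<open>simp add: apply_const_bcontfun\<close>)
  then show "real_section x (\<lambda>_. 1) = 1"
    by (simp add: real_section_def L_one apply_const_bcontfun)
qed

text \<open>
  A real function becomes nonnegative after adding a constant, and \<open>L\<close> fixes constants.
\<close>

lemma Im_L_real:
  assumes f: "continuous_on UNIV (f :: 'a \<Rightarrow> real)"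
  shows "Im (apply_bcontfun (L (Bcontfun (\<lambda>y. complex_of_real (f y)))) x) = 0"
proof -
  obtain B where B: "0 < B" "\<And>x. \<bar>f x\<bar> \<le> B"
    using compact_imp_bounded[OF compact_continuous_image[OF f compact_space]]
    unfolding bounded_pos by auto
  let ?\<phi> = "Bcontfun (\<lambda>y. complex_of_real (f y))"
  let ?c = "cscale_bcontfun (complex_of_real B) (const_bcontfun 1)"
  have "apply_bcontfun (L (?\<phi> + ?c)) x \<in> \<real>\<^sub>\<ge>\<^sub>0"
  proof (rule L_nonneg)
    fix y
    have "apply_bcontfun (?\<phi> + ?c) y = complex_of_real (f y + B)"
      using f by (simp add: apply_Bcontfun_real apply_const_bcontfun)
    then show "apply_bcontfun (?\<phi> + ?c) y \<in> \<real>\<^sub>\<ge>\<^sub>0"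
      using B(2)[of y] by (simp add: abs_le_iff del: of_real_add)
  qed
  then have "apply_bcontfun (L ?\<phi>) x + complex_of_real B \<in> \<real>\<^sub>\<ge>\<^sub>0"
    by (simp add: L_add L_scale L_one apply_const_bcontfun)
  then show ?thesis
    by (auto simp: nonneg_Reals_def complex_eq_iff)
qed

lemma transition_measure_exists:
  "\<exists>\<nu>. \<nu> \<in> prob_measures \<and> (\<forall>\<phi>. apply_bcontfun (L \<phi>) x = (\<integral>y. apply_bcontfun \<phi> y \<partial>\<nu>))"
proof -
  interpret R: normalised_positive_functional "real_section x"
    by (rule normalised_positive_functional_section)
  let ?\<nu> = "R.rep_measure"
  have \<nu>: "?\<nu> \<in> prob_measures"
    using R.prob_space_rep_measure[OF compact_space] by (simp add: prob_measures_def)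
  have L_real: "apply_bcontfun (L (Bcontfun (\<lambda>y. complex_of_real (f y)))) x = complex_of_real (\<integral>y. f y \<partial>?\<nu>)"
    if f: "continuous_on UNIV f" for f
    using R.Riesz_representation[OF compact_space f] Im_L_real[OF f]
    by (simp add: complex_eq_iff real_section_def)
  have "apply_bcontfun (L \<phi>) x = (\<integral>y. apply_bcontfun \<phi> y \<partial>?\<nu>)" for \<phi>
  proof -
    let ?u = "\<lambda>y. Re (apply_bcontfun \<phi> y)" and ?v = "\<lambda>y. Im (apply_bcontfun \<phi> y)"
    have u: "continuous_on UNIV ?u" and v: "continuous_on UNIV ?v"
      by (auto intro!: continuous_intros)
    have "\<phi> = Bcontfun (\<lambda>y. complex_of_real (?u y)) + cscale_bcontfun \<i> (Bcontfun (\<lambda>y. complex_of_real (?v y)))"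
      by (rule bcontfun_eqI) (simp add: apply_Bcontfun_real u v complex_eq)
    then have "apply_bcontfun (L \<phi>) x = apply_bcontfun (L (Bcontfun (\<lambda>y. complex_of_real (?u y))
        + cscale_bcontfun \<i> (Bcontfun (\<lambda>y. complex_of_real (?v y))))) x"
      by simp
    also have "\<dots> = complex_of_real (\<integral>y. ?u y \<partial>?\<nu>) + \<i> * complex_of_real (\<integral>y. ?v y \<partial>?\<nu>)"
      by (simp only: L_add L_scale plus_bcontfun.rep_eq apply_cscale_bcontfun L_real[OF u] L_real[OF v])
    also have "\<dots> = (\<integral>y. apply_bcontfun \<phi> y \<partial>?\<nu>)"
      using integrable_apply_bcontfun[OF \<nu>, of \<phi>] by (simp add: complex_eq_iff)
    finally show ?thesis .
  qed
  with \<nu> show ?thesis by blast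
qed

abbreviation P :: "'a \<Rightarrow> 'a measure" where
  "P \<equiv> transition_prob L"

lemma transition_prob: "P x \<in> prob_measures"
  and L_eq_integral: "apply_bcontfun (L \<phi>) x = (\<integral>y. apply_bcontfun \<phi> y \<partial>P x)"
proof -
  have "\<exists>!\<nu>. \<nu> \<in> prob_measures \<and> (\<forall>\<phi>. apply_bcontfun (L \<phi>) x = (\<integral>y. apply_bcontfun \<phi> y \<partial>\<nu>))"
    using transition_measure_exists[of x] by (auto intro: prob_measures_eqI)
  then have "P x \<in> prob_measures \<and> (\<forall>\<phi>. apply_bcontfun (L \<phi>) x = (\<integral>y. apply_bcontfun \<phi> y \<partial>P x))"
    unfolding transition_prob_def by (rule theI')
  then show "P x \<in> prob_measures" "apply_bcontfun (L \<phi>) x = (\<integral>y. apply_bcontfun \<phi> y \<partial>P x)"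
    by blast+
qed

text \<open>
  On closed sets \<open>x \<mapsto> P(x, F)\<close> is the limit of the continuous functions obtained by applying \<open>L\<close>
  to the cutoffs of \<open>F\<close>, and closed sets generate the Borel sets.
\<close>

lemma P_measurable: "P \<in> borel \<rightarrow>\<^sub>M prob_algebra borel"
proof (rule measurable_prob_algebra_generated[where \<Omega> = UNIV and G = "Collect closed"])
  show "sets (borel :: 'a measure) = sigma_sets UNIV (Collect closed)"
    by (simp add: borel_eq_closed)
  show "Int_stable (Collect (closed :: 'a set \<Rightarrow> bool))"
    by (auto simp: Int_stable_def)
  fix F :: "'a set" assume "F \<in> Collect closed"
  then have F: "closed F" by simp
  show "(\<lambda>x. emeasure (P x) F) \<in> borel_measurable borel"
  proof (cases "F = {}")
    case False
    have "(\<lambda>x. measure (P x) F) \<in> borel_measurable borel"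
    proof (rule borel_measurable_LIMSEQ_real[OF measure_closed_LIMSEQ[OF transition_prob F False]])
      fix k
      let ?\<phi> = "Bcontfun (\<lambda>x. complex_of_real (cutoff F k x))"
      have "(\<integral>y. cutoff F k y \<partial>P x) = Re (apply_bcontfun (L ?\<phi>) x)" for x
        by (simp add: L_eq_integral apply_Bcontfun_real continuous_cutoff)
      then show "(\<lambda>x. \<integral>y. cutoff F k y \<partial>P x) \<in> borel_measurable borel"
        using measurable_apply_bcontfun[of "L ?\<phi>"] by simp
    qed
    moreover have "emeasure (P x) F = ennreal (measure (P x) F)" for x
      using prob_space.finite_measure[OF prob_measuresD(1)[OF transition_prob]]
      by (rule finite_measure.emeasure_eq_measure)
    ultimately show ?thesis by simp
  qed simp
qed (use prob_measuresD[OF transition_prob] in auto)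

lemma bind_prob_measures:
  assumes "\<nu> \<in> prob_measures" "Q \<in> borel \<rightarrow>\<^sub>M prob_algebra borel"
  shows "\<nu> \<bind> Q \<in> prob_measures"
proof -
  have "\<nu> \<in> space (prob_algebra borel)" using assms(1) by (simp add: space_prob_algebra_borel)
  then show ?thesis
    using prob_space_bind'[OF _ assms(2)] sets_bind'[OF _ assms(2)] by (simp add: prob_measures_def)
qed

lemma measurable_prob_measures:
  "\<nu> \<in> prob_measures \<Longrightarrow> Q \<in> borel \<rightarrow>\<^sub>M N \<Longrightarrow> Q \<in> \<nu> \<rightarrow>\<^sub>M N"
  by (simp add: measurable_cong_sets[OF prob_measuresD(2) refl])

lemma dual_operator_eq:
  assumes \<nu>: "\<nu> \<in> prob_measures"
  shows "dual_operator L \<nu> = \<nu> \<bind> P"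
proof -
  have *: "(\<integral>x. apply_bcontfun \<phi> x \<partial>(\<nu> \<bind> P)) = (\<integral>x. apply_bcontfun (L \<phi>) x \<partial>\<nu>)" for \<phi>
    unfolding L_eq_integral
    using prob_measuresD(1)[OF \<nu>] measurable_prob_measures[OF \<nu> P_measurable] measurable_apply_bcontfun norm_bounded
    by (rule integral_bind_bounded_complex)
  show ?thesis
    unfolding dual_operator_def
    using bind_prob_measures[OF \<nu> P_measurable] *
    by (intro the_equality) (auto intro!: prob_measures_eqI)
qed

text \<open>
  The first step is split off, matching the recursion of \<open>extended_operator L ^^ k\<close>, where the
  outermost operator is the first step of the chain.
\<close>

primrec iter_kernel :: "nat \<Rightarrow> 'a \<Rightarrow> 'a measure" where
  "iter_kernel 0 = return borel"
| "iter_kernel (Suc k) = (\<lambda>x. P x \<bind> iter_kernel k)"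

lemma iter_kernel_measurable: "iter_kernel k \<in> borel \<rightarrow>\<^sub>M prob_algebra borel"
  by (induction k) (auto intro: measurable_return_prob_space measurable_bind_prob_space P_measurable)

lemma iter_kernel_prob_measures: "iter_kernel k x \<in> prob_measures"
  using measurable_space[OF iter_kernel_measurable, of x k] by (simp add: space_prob_algebra_borel)

lemma dual_operator_pow_eq:
  "\<nu> \<in> prob_measures \<Longrightarrow> (dual_operator L ^^ k) \<nu> = \<nu> \<bind> iter_kernel k"
proof (induction k arbitrary: \<nu>)
  case 0
  then show ?case by (simp add: bind_return'' prob_measuresD)
next
  case (Suc k)
  have "(dual_operator L ^^ Suc k) \<nu> = (dual_operator L ^^ k) (\<nu> \<bind> P)"
    using Suc.prems by (simp add: funpow_swap1 dual_operator_eq)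
  also have "\<dots> = (\<nu> \<bind> P) \<bind> iter_kernel k"
    using Suc by (intro Suc.IH bind_prob_measures P_measurable)
  also have "\<dots> = \<nu> \<bind> (\<lambda>x. P x \<bind> iter_kernel k)"
    using measurable_prob_measures[OF Suc.prems measurable_prob_algebraD[OF P_measurable]]
      measurable_prob_algebraD[OF iter_kernel_measurable]
    by (rule bind_assoc)
  finally show ?case by simp
qed

end

section \<open>Universally measurable functions and the extended operator\<close>

lemma L_infty_integral_eq:
  assumes "sets \<nu> = sets borel" "\<psi> \<in> borel_measurable borel" "AE y in \<nu>. \<phi> y = \<psi> y"
  shows "L_infty_integral \<nu> \<phi> = (\<integral>y. \<psi> y \<partial>\<nu>)"
proof -
  let ?rep = "\<lambda>\<psi>. \<psi> \<in> borel_measurable borel \<and> (AE y in \<nu>. \<phi> y = \<psi> y)"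
  have "?rep (SOME \<psi>. ?rep \<psi>)"
    using assms by (intro someI[of ?rep \<psi>]) auto
  then have "AE y in \<nu>. (SOME \<psi>. ?rep \<psi>) y = \<psi> y" "(SOME \<psi>. ?rep \<psi>) \<in> borel_measurable borel"
    using assms(3) by (auto elim: eventually_elim2)
  then show ?thesis
    unfolding L_infty_integral_def using assms
    by (intro integral_cong_AE) (auto simp: measurable_cong_sets[OF assms(1) refl])
qed

text \<open>
  Truncating a representative keeps the bound of \<open>\<phi>\<close> and changes it only on a null set.
\<close>

lemma L_infty_representative:
  assumes \<phi>: "\<phi> \<in> L_infty" and \<nu>: "\<nu> \<in> prob_measures" and B: "\<And>x. norm (\<phi> x) \<le> B"
  obtains \<psi> where "\<psi> \<in> borel_measurable borel" "\<And>x. norm (\<psi> x) \<le> B" "AE x in \<nu>. \<phi> x = \<psi> x"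
proof -
  obtain \<psi> where \<psi> [measurable]: "\<psi> \<in> borel_measurable borel" and eq: "AE x in \<nu>. \<phi> x = \<psi> x"
    using \<phi> \<nu> by (auto simp: L_infty_def)
  have B_nonneg: "0 \<le> B"
    using B norm_ge_zero order_trans by blast
  show thesis
  proof (rule that[of "\<lambda>x. if norm (\<psi> x) \<le> B then \<psi> x else 0"])
    show "AE x in \<nu>. \<phi> x = (if norm (\<psi> x) \<le> B then \<psi> x else 0)"
      using eq by eventually_elim (metis B)
  qed (use B_nonneg in auto)
qed

lemma L_infty_bound:
  assumes "\<phi> \<in> L_infty" obtains B where "\<And>x. norm (\<phi> x) \<le> B"
  using assms by (auto simp: L_infty_def bounded_iff)

lemma norm_L_infty_integral_le:
  assumes \<phi>: "\<phi> \<in> L_infty" and \<nu>: "\<nu> \<in> prob_measures" and B: "\<And>x. norm (\<phi> x) \<le> B"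
  shows "norm (L_infty_integral \<nu> \<phi>) \<le> B"
proof -
  interpret prob_space \<nu> using \<nu> by (rule prob_measuresD)
  obtain \<psi> where \<psi>: "\<psi> \<in> borel_measurable borel" "\<And>x. norm (\<psi> x) \<le> B" "AE x in \<nu>. \<phi> x = \<psi> x"
    using L_infty_representative[OF assms] by blast
  have "integrable \<nu> \<psi>"
    using \<psi> by (intro integrable_const_bound[of _ B])
      (auto simp: measurable_cong_sets[OF prob_measuresD(2)[OF \<nu>] refl])
  then have "norm (\<integral>y. \<psi> y \<partial>\<nu>) \<le> B"
    using \<psi>(2) by (intro order_trans[OF integral_norm_bound] integral_le_const) auto
  then show ?thesis
    using L_infty_integral_eq[OF prob_measuresD(2)[OF \<nu>] \<psi>(1,3)] by simp
qed

lemma measurable_integral_kernel: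
  fixes \<psi> :: "'b \<Rightarrow> complex"
  assumes "Q \<in> M \<rightarrow>\<^sub>M prob_algebra N" "\<psi> \<in> borel_measurable N"
  shows "(\<lambda>x. \<integral>y. \<psi> y \<partial>Q x) \<in> borel_measurable M"
  using measurable_prob_algebraD[OF assms(1)] integral_measurable_subprob_algebra[OF assms(2)]
  by (rule measurable_compose)

text \<open>
  A representative \<open>\<psi>\<close> of \<open>\<phi>\<close> for the measure \<open>\<nu> \<bind> Q\<close> represents \<open>\<phi>\<close> also for \<open>Q x\<close>, for almost
  every \<open>x\<close>. The Borel function \<open>x \<mapsto> \<integral> \<psi> dQ(x, \<cdot>)\<close> is thus a representative for \<open>\<nu>\<close>.
\<close>

lemma (in compact_transfer_operator) kernel_L_infty:
  assumes \<phi>: "\<phi> \<in> L_infty" and Q: "Q \<in> borel \<rightarrow>\<^sub>M prob_algebra borel"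
  shows "(\<lambda>x. L_infty_integral (Q x) \<phi>) \<in> L_infty"
    and "\<nu> \<in> prob_measures \<Longrightarrow> \<psi> \<in> borel_measurable borel \<Longrightarrow> AE y in \<nu> \<bind> Q. \<phi> y = \<psi> y \<Longrightarrow>
      AE x in \<nu>. L_infty_integral (Q x) \<phi> = (\<integral>y. \<psi> y \<partial>Q x)"
proof -
  have Qx: "Q x \<in> prob_measures" for x
    using measurable_space[OF Q, of x] by (simp add: space_prob_algebra_borel)
  show *: "AE x in \<nu>. L_infty_integral (Q x) \<phi> = (\<integral>y. \<psi> y \<partial>Q x)"
    if \<nu>: "\<nu> \<in> prob_measures" and \<psi>: "\<psi> \<in> borel_measurable borel" and eq: "AE y in \<nu> \<bind> Q. \<phi> y = \<psi> y" for \<nu> \<psi>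
  proof -
    have "AE x in \<nu>. AE y in Q x. \<phi> y = \<psi> y"
      using prob_measuresD(3)[OF \<nu>] by (intro AE_bindD[OF measurable_prob_measures[OF \<nu> Q] _ eq]) simp
    then show ?thesis
      by eventually_elim (intro L_infty_integral_eq prob_measuresD(2) Qx \<psi>)
  qed
  obtain B where B: "\<And>x. norm (\<phi> x) \<le> B" using \<phi> by (rule L_infty_bound) blast
  have "bounded (range (\<lambda>x. L_infty_integral (Q x) \<phi>))"
    using norm_L_infty_integral_le[OF \<phi> Qx B] by (auto simp: bounded_iff)
  moreover have "\<exists>\<psi>\<in>borel_measurable borel. AE x in \<nu>. L_infty_integral (Q x) \<phi> = \<psi> x"
    if \<nu>: "\<nu> \<in> prob_measures" for \<nu>
  proof -
    obtain \<psi> where \<psi>: "\<psi> \<in> borel_measurable borel" "AE y in \<nu> \<bind> Q. \<phi> y = \<psi> y"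
      using \<phi> bind_prob_measures[OF \<nu> Q] by (auto simp: L_infty_def)
    show ?thesis
      using *[OF \<nu> \<psi>] measurable_integral_kernel[OF Q \<psi>(1)]
      by (rule bexI[where x = "\<lambda>x. \<integral>y. \<psi> y \<partial>Q x"])
  qed
  ultimately show "(\<lambda>x. L_infty_integral (Q x) \<phi>) \<in> L_infty"
    by (simp add: L_infty_def)
qed

lemma L_infty_integral_return:
  fixes \<phi> :: "'a::metric_space \<Rightarrow> complex"
  assumes "\<phi> \<in> L_infty" shows "L_infty_integral (return borel x) \<phi> = \<phi> x"
proof -
  have r: "return borel x \<in> prob_measures"
    by (simp add: prob_measures_def prob_space_return)
  then obtain \<psi> where \<psi>: "\<psi> \<in> borel_measurable borel" and eq: "AE y in return borel x. \<phi> y = \<psi> y"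
    using assms by (auto simp: L_infty_def)
  have "\<phi> x = \<psi> x"
  proof -
    obtain Z where Z: "{y. \<phi> y \<noteq> \<psi> y} \<subseteq> Z" "Z \<in> null_sets (return borel x)"
      using eq by (auto elim: AE_E simp: null_sets_def)
    then have "x \<notin> Z"
      by (auto simp: null_sets_def indicator_def split: if_splits)
    with Z(1) show ?thesis by auto
  qed
  then show ?thesis
    using L_infty_integral_eq[OF _ \<psi> eq] \<psi> by (simp add: integral_return)
qed

context compact_transfer_operator
begin

text \<open>
  The representative of \<open>\<phi>\<close> has to be chosen anew for each \<open>x\<close>, namely for the measure
  \<open>P x \<bind> iter_kernel k\<close>; it then serves for almost all intermediate points as well.
\<close>

lemma extended_operator_pow_eq:
  assumes \<phi>: "\<phi> \<in> L_infty"
  shows "(extended_operator L ^^ k) \<phi> = (\<lambda>x. L_infty_integral (iter_kernel k x) \<phi>)"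
proof (induction k)
  case 0
  then show ?case using \<phi> by (simp add: L_infty_integral_return)
next
  case (Suc k)
  obtain B where B: "\<And>x. norm (\<phi> x) \<le> B" using \<phi> by (rule L_infty_bound) blast
  show ?case
  proof
    fix x
    note Px = transition_prob[of x] and Kk = iter_kernel_measurable[of k]
    have PK: "P x \<bind> iter_kernel k \<in> prob_measures"
      using Px Kk by (rule bind_prob_measures)
    obtain \<psi> where \<psi>: "\<psi> \<in> borel_measurable borel" "\<And>y. norm (\<psi> y) \<le> B"
      "AE y in P x \<bind> iter_kernel k. \<phi> y = \<psi> y"
      using L_infty_representative[OF \<phi> PK B] by blast
    have "(extended_operator L ^^ Suc k) \<phi> x
        = L_infty_integral (P x) (\<lambda>y. L_infty_integral (iter_kernel k y) \<phi>)"
      by (simp add: extended_operator_def Suc)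
    also have "\<dots> = (\<integral>y. (\<integral>z. \<psi> z \<partial>iter_kernel k y) \<partial>P x)"
      using prob_measuresD(2)[OF Px] measurable_integral_kernel[OF Kk \<psi>(1)]
        kernel_L_infty(2)[OF \<phi> Kk Px \<psi>(1,3)]
      by (rule L_infty_integral_eq)
    also have "\<dots> = (\<integral>z. \<psi> z \<partial>(P x \<bind> iter_kernel k))"
      using prob_measuresD(1)[OF Px] measurable_prob_measures[OF Px Kk] \<psi>(1,2)
      by (rule integral_bind_bounded_complex[symmetric])
    also have "\<dots> = L_infty_integral (iter_kernel (Suc k) x) \<phi>"
      using L_infty_integral_eq[OF prob_measuresD(2)[OF PK] \<psi>(1,3)] by simp
    finally show "(extended_operator L ^^ Suc k) \<phi> x = L_infty_integral (iter_kernel (Suc k) x) \<phi>" .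
  qed
qed

lemma extended_operator_pow_L_infty: "\<phi> \<in> L_infty \<Longrightarrow> (extended_operator L ^^ k) \<phi> \<in> L_infty"
  unfolding extended_operator_pow_eq by (rule kernel_L_infty(1)[OF _ iter_kernel_measurable])

end

lemma integral_Complex:
  assumes "integrable M u" "integrable M v"
  shows "(\<integral>x. Complex (u x) (v x) \<partial>M) = Complex (\<integral>x. u x \<partial>M) (\<integral>x. v x \<partial>M)"
  using assms unfolding Complex_eq by simp

section \<open>The pointwise ergodic theorem for transfer operators\<close>

theorem theorem2:
  fixes L :: "('a::metric_space \<Rightarrow>\<^sub>C complex) \<Rightarrow> ('a \<Rightarrow>\<^sub>C complex)"
    and \<mu> :: "'a measure" and p :: nat and \<phi> :: "'a \<Rightarrow> complex"
  assumes "compact (UNIV :: 'a set)"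
    and "transfer_operator L"
    and "\<mu> \<in> prob_measures"
    and "p \<ge> 1"
    and "(dual_operator L ^^ p) \<mu> = \<mu>"
    and "\<phi> \<in> L_infty"
  shows "(AE x in \<mu>. convergent (\<lambda>n. birkhoff_average L p \<phi> n x)) \<and>
    (ergodic_dual L p \<mu> \<longrightarrow> (AE x in \<mu>. birkhoff_limit L p \<phi> x = L_infty_integral \<mu> \<phi>))"
proof -
  interpret compact_transfer_operator L
    using assms by unfold_locales
  note \<mu> = \<open>\<mu> \<in> prob_measures\<close> and \<phi> = \<open>\<phi> \<in> L_infty\<close>
  let ?K = "iter_kernel p" and ?E = "extended_operator L"
  have sets_\<mu>: "sets \<mu> = sets borel" and space_\<mu>: "space \<mu> = UNIV"
    using \<mu> by (rule prob_measuresD)+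
  note meas_\<mu> = measurable_cong_sets[OF sets_\<mu> refl]
  have stat: "\<mu> \<bind> ?K = \<mu>"
    using dual_operator_pow_eq[OF \<mu>] assms(5) by simp
  have "prob_algebra \<mu> = prob_algebra borel"
    using subprob_algebra_cong[OF sets_\<mu>] by (simp add: prob_algebra_def)
  then have "?K \<in> \<mu> \<rightarrow>\<^sub>M prob_algebra \<mu>"
    using iter_kernel_measurable by (simp add: meas_\<mu>)
  with prob_measuresD(1)[OF \<mu>] stat interpret S: stationary_kernel \<mu> ?K
    by (intro stationary_kernel.intro stationary_kernel_axioms.intro)
  obtain B where B: "\<And>x. norm (\<phi> x) \<le> B" using \<phi> by (rule L_infty_bound) blast
  obtain \<psi> where \<psi>: "\<psi> \<in> borel_measurable borel" "\<And>x. norm (\<psi> x) \<le> B" "AE x in \<mu>. \<phi> x = \<psi> x"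
    using L_infty_representative[OF \<phi> \<mu> B] by blast
  let ?u = "\<lambda>x. Re (\<psi> x)" and ?v = "\<lambda>x. Im (\<psi> x)"
  have u: "S.bdd_fun ?u" and v: "S.bdd_fun ?v"
    using \<psi>(1,2) by (auto intro!: S.bdd_funI[of _ B] order_trans[OF abs_Re_le_cmod]
      order_trans[OF abs_Im_le_cmod] simp: meas_\<mu>)
  \<comment> \<open>One null set is discarded in each step: since \<open>\<mu>\<close> is stationary, an equality that holds
    \<open>\<mu>\<close>-almost everywhere also holds almost everywhere for \<open>?K x\<close>, for \<open>\<mu>\<close>-almost every \<open>x\<close>.\<close>
  have E_pow: "AE x in \<mu>. (?E ^^ (j * p)) \<phi> x = Complex ((S.T ^^ j) ?u x) ((S.T ^^ j) ?v x)" for j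
  proof (induction j)
    case 0
    then show ?case using \<psi>(3) by simp
  next
    case (Suc j)
    let ?f = "(?E ^^ (j * p)) \<phi>"
    let ?g = "\<lambda>x. Complex ((S.T ^^ j) ?u x) ((S.T ^^ j) ?v x)"
    note uj = S.bdd_fun_T_pow[OF u, of j] and vj = S.bdd_fun_T_pow[OF v, of j]
    have f: "?f \<in> L_infty" using \<phi> by (rule extended_operator_pow_L_infty)
    have g: "?g \<in> borel_measurable borel"
      using S.bdd_fun_measurable[OF uj] S.bdd_fun_measurable[OF vj] by (simp add: meas_\<mu> Complex_eq)
    have "AE x in \<mu>. L_infty_integral (?K x) ?f = (\<integral>y. ?g y \<partial>?K x)"
      by (rule kernel_L_infty(2)[OF f iter_kernel_measurable \<mu> g]) (simp only: stat Suc)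
    then show ?case
    proof eventually_elim
      case (elim x)
      have x: "x \<in> space \<mu>" using space_\<mu> by simp
      have "(?E ^^ (Suc j * p)) \<phi> x = (?E ^^ p) ?f x"
        by (simp add: funpow_add)
      also have "\<dots> = (\<integral>y. ?g y \<partial>?K x)"
        using elim extended_operator_pow_eq[OF f] by simp
      also have "\<dots> = Complex ((S.T ^^ Suc j) ?u x) ((S.T ^^ Suc j) ?v x)"
        using S.bdd_fun_integrable_kernel[OF uj x] S.bdd_fun_integrable_kernel[OF vj x]
        by (simp add: integral_Complex S.T_def)
      finally show ?case .
    qed
  qed
  then have "AE x in \<mu>. \<forall>j. (?E ^^ (j * p)) \<phi> x = Complex ((S.T ^^ j) ?u x) ((S.T ^^ j) ?v x)"
    by (simp add: AE_all_countable)
  then have avg: "AE x in \<mu>. \<forall>n. birkhoff_average L p \<phi> n x = Complex (S.avg n ?u x) (S.avg n ?v x)"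
    by eventually_elim
      (simp add: birkhoff_average_def S.avg_def S.S_def complex_eq_iff)
  let ?hu = "S.upper_limit ?u" and ?hv = "S.upper_limit ?v"
  have lim: "AE x in \<mu>. (\<lambda>n. birkhoff_average L p \<phi> n x) \<longlonglongrightarrow> Complex (?hu x) (?hv x)"
    using avg S.pointwise_ergodic(3)[OF u] S.pointwise_ergodic(3)[OF v]
    by eventually_elim (simp add: tendsto_Complex)
  show ?thesis
  proof (intro conjI impI)
    show "AE x in \<mu>. convergent (\<lambda>n. birkhoff_average L p \<phi> n x)"
      using lim by eventually_elim (auto simp: convergent_def)
    assume erg: "ergodic_dual L p \<mu>"
    \<comment> \<open>The invariance of sets in the definition of ergodicity is phrased with the complex extended
      operator; on indicators it agrees with the real operator of the kernel.\<close>
    have level: "S.prob A \<in> {0, 1}"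
      if A: "A \<in> sets \<mu>" and inv: "AE x in \<mu>. S.T (indicator A) x = indicator A x" for A
    proof -
      have A': "A \<in> sets borel" using A sets_\<mu> by simp
      have ind: "(indicator A :: 'a \<Rightarrow> complex) \<in> borel_measurable borel"
        using A' by simp
      then have "(indicator A :: 'a \<Rightarrow> complex) \<in> L_infty"
        by (auto simp: L_infty_def bounded_iff indicator_def intro!: exI[of _ 1] bexI[of _ "indicator A"])
      then have "(?E ^^ p) (indicator A) x = L_infty_integral (?K x) (indicator A)" for x
        by (simp add: extended_operator_pow_eq)
      also have "\<dots> x = (\<integral>y. indicator A y \<partial>?K x)" for x
        using ind prob_measuresD(2)[OF iter_kernel_prob_measures]
        by (intro L_infty_integral_eq) auto
      also have "(\<integral>y. (indicator A y :: complex) \<partial>?K x) = complex_of_real (S.T (indicator A) x)" for x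
        unfolding S.T_def integral_complex_of_real[symmetric] by (simp add: of_real_indicator)
      finally have "ae_invariant L p \<mu> A"
        using inv unfolding ae_invariant_def by (auto elim!: eventually_mono simp: of_real_indicator)
      then show ?thesis using erg A' by (auto simp: ergodic_dual_def)
    qed
    have const: "AE x in \<mu>. ?hu x = (\<integral>x. ?u x \<partial>\<mu>)" "AE x in \<mu>. ?hv x = (\<integral>x. ?v x \<partial>\<mu>)"
      using S.invariant_function_const[OF level] S.pointwise_ergodic(1,2) u v
      by (metis S.bdd_fun_upper_limit)+
    have int: "L_infty_integral \<mu> \<phi> = Complex (\<integral>x. ?u x \<partial>\<mu>) (\<integral>x. ?v x \<partial>\<mu>)"
      using L_infty_integral_eq[OF sets_\<mu> \<psi>(1,3)]
        integral_Complex[OF S.bdd_fun_integrable[OF u] S.bdd_fun_integrable[OF v]]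
      by simp
    from lim const show "AE x in \<mu>. birkhoff_limit L p \<phi> x = L_infty_integral \<mu> \<phi>"
      by eventually_elim (simp add: birkhoff_limit_def int limI)
  qed
qed

end
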